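(* Let $N\ge 2$ and $M>2$ be integers and consider the indirect control system described in the context, with real Lie algebra $\mathcal{L}$ generated by $iH_0$, $iH_x^j=i(1_S\otimes\sigma_x^j)$ and $iH_y^j=i(1_S\otimes\sigma_y^j)$, $j=1,\dots,M$. If Conditions 1, 2 and 3 are satisfied, then $\mathcal{L}=su(2^M N)$.
   Context: The controlled system is $\mathbb{C}^N$ with orthonormal basis $|1\rangle,\dots,|N\rangle$; $e_{jk}=|j\rangle\langle k|$. $H_S=\sum_{j=1}^N E_j e_{jj}$ with real $E_j$, $\sum_j E_j=0$. For $1\le j<k\le N$: $x_{jk}=e_{jk}+e_{kj}$, $y_{jk}=i(e_{jk}-e_{kj})$, $h_j=e_{jj}-e_{j+1,j+1}$; $x_j=x_{j,j+1}$, $y_j=y_{j,j+1}$; $s_j^{(1)}=x_j$, $s_j^{(2)}=y_j$. The accessor is $(\mathbb{C}^2)^{\otimes M}$ ($M$ qubits); $\sigma_\alpha^j$ is the Pauli matrix $\sigma_\alpha$ ($\alpha=x,y,z$) on the $j$-th qubit, $\sigma_0=1$, and $\sigma_{[\alpha]}=\prod_{j=1}^M\sigma^j_{\alpha_j}$ for $[\alpha]\in\{x,y,z,0\}^M$. $1_S,1_A$ denote identities. $H_A=\sum_{j=1}^M\hbar\omega_j\sigma_z^j+\sum_{j=1}^{M-1}c_j\sigma_x^j\sigma_x^{j+1}$; $H_S'=\sum_{j=1}^{N-1}d_j x_j\otimes 1_A$; $H_{SA}=\sum_{j=1}^{N-1}\sum_{k=1}^2\sum_{[\alpha]\in\{x,y\}^M}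 g^{j(k)}_{[\alpha]}\, s_j^{(k)}\otimes\sigma_{[\alpha]}$; all coefficients real; $H_0=H_S\otimes 1_A+H_S'+1_S\otimes H_A+H_{SA}$. (The control Hamiltonian is $H=H_0+\sum_j(f_j(t)H_x^j+f'_j(t)H_y^j)$, and complete controllability means $\mathcal{L}=su(2^MN)$.) Condition 1: $c_j\neq 0$ for $j=1,\dots,M-1$. Condition 2: there exist $2(N-1)$ elements $[\beta]_1,\dots,[\beta]_{2(N-1)}$ of $\{x,y\}^M$ such that the $2(N-1)\times 2(N-1)$ matrix $G$ whose $r$-th row is $(g^{1(1)}_{[\beta]_r},\dots,g^{(N-1)(1)}_{[\beta]_r},g^{1(2)}_{[\beta]_r},\dots,g^{(N-1)(2)}_{[\beta]_r})$ has nonzero determinant. Condition 3: the $N$-level system with drift $H_S$ and control Hamiltonian $\sum_{j=1}^{N-1}d_jx_j$ is completely controllable, i.e. the real Lie algebra generated by $iH_S$ and $i\sum_{j=1}^{N-1}d_jx_j$ equals $su(N)$. *)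

theory Defs
  imports "Jordan_Normal_Form.Determinant"
begin

definition kron :: "complex mat \<Rightarrow> complex mat \<Rightarrow> complex mat" where
  "kron A B = mat (dim_row A * dim_row B) (dim_col A * dim_col B)
     (\<lambda>(i, j). A $$ (i div dim_row B, j div dim_col B) * B $$ (i mod dim_row B, j mod dim_col B))"

definition msum :: "nat \<Rightarrow> ('i \<Rightarrow> complex mat) \<Rightarrow> 'i set \<Rightarrow> complex mat" where
  "msum n f I = mat n n (\<lambda>(a, b). \<Sum>i\<in>I. f i $$ (a, b))"

(* e_{jk} = |j><k| on C^N, basis indices j,k in {1..N} (stored 0-based) *)
definition e_mat :: "nat \<Rightarrow> nat \<Rightarrow> nat \<Rightarrow> complex mat" where
  "e_mat N j k = mat N N (\<lambda>(a, b). if a = j - 1 \<and> b = k - 1 then 1 else 0)"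

definition x_mat :: "nat \<Rightarrow> nat \<Rightarrow> complex mat" where
  "x_mat N j = e_mat N j (j + 1) + e_mat N (j + 1) j"

definition y_mat :: "nat \<Rightarrow> nat \<Rightarrow> complex mat" where
  "y_mat N j = \<i> \<cdot>\<^sub>m (e_mat N j (j + 1) - e_mat N (j + 1) j)"

definition s_mat :: "nat \<Rightarrow> nat \<Rightarrow> nat \<Rightarrow> complex mat" where
  "s_mat N j k = (if k = 1 then x_mat N j else y_mat N j)"

datatype pauli = P0 | PX | PY | PZ

definition pauli_mat :: "pauli \<Rightarrow> complex mat" where
  "pauli_mat p = (case p of
       P0 \<Rightarrow> 1\<^sub>m 2
     | PX \<Rightarrow> mat 2 2 (\<lambda>(a, b). if a \<noteq> b then 1 else 0)
     | PY \<Rightarrow> mat 2 2 (\<lambda>(a, b). if a = 0 \<and> b = 1 then - \<i> else if a = 1 \<and> b = 0 then \<i> else 0)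
     | PZ \<Rightarrow> mat 2 2 (\<lambda>(a, b). if a = b then (if a = 0 then 1 else -1) else 0))"

(* sigma_[alpha] = prod_j sigma_{alpha_j}^j, alpha given as a list of length M (qubit j = entry j-1) *)
definition pauli_string :: "pauli list \<Rightarrow> complex mat" where
  "pauli_string as = foldr (\<lambda>p B. kron (pauli_mat p) B) as (1\<^sub>m 1)"

definition sigma_on :: "nat \<Rightarrow> nat \<Rightarrow> pauli \<Rightarrow> complex mat" where
  "sigma_on M j p = pauli_string (map (\<lambda>i. if i = j then p else P0) [1..<M+1])"

definition xy_strings :: "nat \<Rightarrow> pauli list set" where
  "xy_strings M = {as. length as = M \<and> set as \<subseteq> {PX, PY}}"

definition H_S :: "nat \<Rightarrow> (nat \<Rightarrow> real) \<Rightarrow> complex mat" where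
  "H_S N E = msum N (\<lambda>j. complex_of_real (E j) \<cdot>\<^sub>m e_mat N j j) {1..N}"

definition H_ctrl_S :: "nat \<Rightarrow> (nat \<Rightarrow> real) \<Rightarrow> complex mat" where
  "H_ctrl_S N d = msum N (\<lambda>j. complex_of_real (d j) \<cdot>\<^sub>m x_mat N j) {1..N-1}"

(* H_A = sum_j (hbar omega_j) sigma_z^j + sum_j c_j sigma_x^j sigma_x^{j+1}; w j stands for hbar*omega_j *)
definition H_A :: "nat \<Rightarrow> (nat \<Rightarrow> real) \<Rightarrow> (nat \<Rightarrow> real) \<Rightarrow> complex mat" where
  "H_A M w c = msum (2^M) (\<lambda>j. complex_of_real (w j) \<cdot>\<^sub>m sigma_on M j PZ) {1..M}
             + msum (2^M) (\<lambda>j. complex_of_real (c j) \<cdot>\<^sub>m (sigma_on M j PX * sigma_on M (j+1) PX)) {1..M-1}"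

definition H_SA :: "nat \<Rightarrow> nat \<Rightarrow> (nat \<Rightarrow> nat \<Rightarrow> pauli list \<Rightarrow> real) \<Rightarrow> complex mat" where
  "H_SA N M g = msum (N * 2^M)
     (\<lambda>(j, k, as). complex_of_real (g j k as) \<cdot>\<^sub>m kron (s_mat N j k) (pauli_string as))
     ({1..N-1} \<times> {1..2} \<times> xy_strings M)"

definition H_0 :: "nat \<Rightarrow> nat \<Rightarrow> (nat \<Rightarrow> real) \<Rightarrow> (nat \<Rightarrow> real) \<Rightarrow> (nat \<Rightarrow> real) \<Rightarrow> (nat \<Rightarrow> real)
                    \<Rightarrow> (nat \<Rightarrow> nat \<Rightarrow> pauli list \<Rightarrow> real) \<Rightarrow> complex mat" where
  "H_0 N M E d w c g = kron (H_S N E) (1\<^sub>m (2^M)) + kron (H_ctrl_S N d) (1\<^sub>m (2^M))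
                      + kron (1\<^sub>m N) (H_A M w c) + H_SA N M g"

definition H_x :: "nat \<Rightarrow> nat \<Rightarrow> nat \<Rightarrow> complex mat" where
  "H_x N M j = kron (1\<^sub>m N) (sigma_on M j PX)"
definition H_y :: "nat \<Rightarrow> nat \<Rightarrow> nat \<Rightarrow> complex mat" where
  "H_y N M j = kron (1\<^sub>m N) (sigma_on M j PY)"

inductive_set lie_gen :: "nat \<Rightarrow> complex mat set \<Rightarrow> complex mat set" for n S where
  gen: "A \<in> S \<Longrightarrow> A \<in> lie_gen n S"
| zero: "0\<^sub>m n n \<in> lie_gen n S"
| add: "A \<in> lie_gen n S \<Longrightarrow> B \<in> lie_gen n S \<Longrightarrow> A + B \<in> lie_gen n S"
| smult: "A \<in> lie_gen n S \<Longrightarrow> complex_of_real r \<cdot>\<^sub>m A \<in> lie_gen n S"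
| bracket: "A \<in> lie_gen n S \<Longrightarrow> B \<in> lie_gen n S \<Longrightarrow> A * B - B * A \<in> lie_gen n S"

definition mtrace :: "complex mat \<Rightarrow> complex" where
  "mtrace A = (\<Sum>i<dim_row A. A $$ (i, i))"

definition su :: "nat \<Rightarrow> complex mat set" where
  "su n = {A \<in> carrier_mat n n. (\<forall>i<n. \<forall>j<n. A $$ (i, j) = - cnj (A $$ (j, i))) \<and> mtrace A = 0}"

(* Condition 2 matrix G: row r (0-based) uses beta r; columns g^{1(1)},...,g^{(N-1)(1)},g^{1(2)},...,g^{(N-1)(2)} *)
definition G_mat :: "nat \<Rightarrow> (nat \<Rightarrow> nat \<Rightarrow> pauli list \<Rightarrow> real) \<Rightarrow> (nat \<Rightarrow> pauli list) \<Rightarrow> real mat" where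
  "G_mat N g \<beta> = mat (2*(N-1)) (2*(N-1))
     (\<lambda>(r, col). if col < N - 1 then g (col + 1) 1 (\<beta> r) else g (col - (N - 1) + 1) 2 (\<beta> r))"

end

theory Submission
  imports Defs
begin

text \<open>
  Inside \<open>su n\<close> it suffices to show that the complexification \<open>L\<close> of the generated algebra is all of
  \<open>sl n\<close>. The controls provide \<open>sl 2\<close> on every qubit. Double commutators with a Pauli matrix on one qubit
  delete the terms of \<open>H\<^sub>0\<close> carrying the identity or that same matrix there; as \<open>M > 2\<close>, every term of
  \<open>H\<^sub>0\<close> outside \<open>H\<^sub>S\<^sub>A\<close> is the identity on some qubit, so doing this on all qubits isolates
  \<open>(\<Sum> g s\<^sub>j\<^sup>(\<^sup>k\<^sup>)) \<otimes> \<sigma>\<^sub>[\<^sub>\<beta>\<^sub>]\<close> for each \<open>[\<beta>]\<close>. Inverting \<open>G\<close> and rotating the qubits gives \<open>e\<^sub>j\<^sub>,\<^sub>j\<^sub>+\<^sub>1 \<otimes> B\<close> and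
  \<open>e\<^sub>j\<^sub>+\<^sub>1\<^sub>,\<^sub>j \<otimes> B\<close> for every product \<open>B\<close> of traceless factors, and after subtracting \<open>H\<^sub>S\<^sub>A\<close> the
  neighbour couplings \<open>\<sigma>\<^sub>x \<sigma>\<^sub>x\<close> are isolated as well. Commutators with these couplings and the triple product
  \<open>[[e \<otimes> B, e\<^sup>* \<otimes> C], e \<otimes> D] = e \<otimes> (BCD + DCB)\<close> remove the tracelessness restriction on \<open>B\<close>. So \<open>L\<close>
  contains matrix units that link all pairs of basis vectors, hence \<open>sl n\<close>.
\<close>

section \<open>Generated Lie algebras and their complexification\<close>

lemma lie_gen_carrier:
  assumes "S \<subseteq> carrier_mat n n" "A \<in> lie_gen n S"
  shows "A \<in> carrier_mat n n"
  using assms(2) by induction (use assms(1) in auto)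

lemma bracket_entry:
  fixes A B :: "complex mat"
  assumes "A \<in> carrier_mat n n" "B \<in> carrier_mat n n" "a < n" "b < n"
  shows "(A * B - B * A) $$ (a, b) = (\<Sum>k<n. A $$ (a,k) * B $$ (k,b) - B $$ (a,k) * A $$ (k,b))"
  using assms by (simp add: scalar_prod_def sum_subtractf lessThan_atLeast0)

lemma suI:
  assumes "A \<in> carrier_mat n n" "\<And>i j. i < n \<Longrightarrow> j < n \<Longrightarrow> A $$ (i, j) = - cnj (A $$ (j, i))" "mtrace A = 0"
  shows "A \<in> su n"
  using assms unfolding su_def by blast

lemma suD:
  assumes "A \<in> su n"
  shows "A \<in> carrier_mat n n" "i < n \<Longrightarrow> j < n \<Longrightarrow> A $$ (i, j) = - cnj (A $$ (j, i))" "mtrace A = 0"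
  using assms unfolding su_def by blast+

text \<open>Skew-Hermitian traceless matrices are closed under every rule of \<open>lie_gen\<close>.
  This gives one inclusion of the theorem and is also what permits the descent from the
  complexification.\<close>

lemma lie_gen_subset_su:
  assumes "S \<subseteq> su n"
  shows "lie_gen n S \<subseteq> su n"
proof
  fix A assume "A \<in> lie_gen n S"
  then show "A \<in> su n"
  proof induction
    case (gen A)
    then show ?case using assms by auto
  next
    case zero
    then show ?case by (intro suI) (auto simp: mtrace_def)
  next
    case (add A B)
    note c = suD(1)[OF add.IH(1)] suD(1)[OF add.IH(2)]
    have "mtrace (A + B) = mtrace A + mtrace B"
      using c by (simp add: mtrace_def sum.distrib)
    then have "mtrace (A + B) = 0"
      using suD(3)[OF add.IH(1)] suD(3)[OF add.IH(2)] by simp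
    moreover have "(A + B) $$ (i, j) = - cnj ((A + B) $$ (j, i))" if "i < n" "j < n" for i j
      using that c by (simp add: suD(2)[OF add.IH(1) that] suD(2)[OF add.IH(2) that])
    moreover have "A + B \<in> carrier_mat n n" using c by simp
    ultimately show ?case by (blast intro: suI)
  next
    case (smult A r)
    note c = suD(1)[OF smult.IH]
    have "mtrace (complex_of_real r \<cdot>\<^sub>m A) = r * mtrace A"
      using c by (simp add: mtrace_def sum_distrib_left)
    then have "mtrace (complex_of_real r \<cdot>\<^sub>m A) = 0"
      using suD(3)[OF smult.IH] by simp
    moreover have "(complex_of_real r \<cdot>\<^sub>m A) $$ (i, j) = - cnj ((complex_of_real r \<cdot>\<^sub>m A) $$ (j, i))"
      if "i < n" "j < n" for i j
      using arg_cong[OF suD(2)[OF smult.IH that], of "\<lambda>x. complex_of_real r * x"] that c by simp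
    moreover have "complex_of_real r \<cdot>\<^sub>m A \<in> carrier_mat n n" using c by simp
    ultimately show ?case by (blast intro: suI)
  next
    case (bracket A B)
    note c = suD(1)[OF bracket.IH(1)] suD(1)[OF bracket.IH(2)]
    have "mtrace (A * B - B * A)
        = (\<Sum>i<n. \<Sum>k<n. A $$ (i,k) * B $$ (k,i)) - (\<Sum>i<n. \<Sum>k<n. B $$ (i,k) * A $$ (k,i))"
      using c by (simp add: mtrace_def bracket_entry sum_subtractf del: index_minus_mat(1) index_mult_mat(1))
    also have "(\<Sum>i<n. \<Sum>k<n. B $$ (i,k) * A $$ (k,i)) = (\<Sum>i<n. \<Sum>k<n. A $$ (i,k) * B $$ (k,i))"
      by (subst sum.swap) (simp add: mult.commute)
    finally have "mtrace (A * B - B * A) = 0" by simp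
    moreover have "(A * B - B * A) $$ (i, j) = - cnj ((A * B - B * A) $$ (j, i))"
      if ij: "i < n" "j < n" for i j
    proof -
      have "A $$ (i,k) * B $$ (k,j) - B $$ (i,k) * A $$ (k,j)
          = - cnj (A $$ (j,k) * B $$ (k,i) - B $$ (j,k) * A $$ (k,i))" if "k < n" for k
        unfolding suD(2)[OF bracket.IH(1) ij(1) that] suD(2)[OF bracket.IH(2) ij(1) that]
          suD(2)[OF bracket.IH(1) that ij(2)] suD(2)[OF bracket.IH(2) that ij(2)]
        by simp
      then show ?thesis
        unfolding bracket_entry[OF c ij] bracket_entry[OF c ij(2,1)] cnj_sum sum_negf[symmetric]
        by (intro sum.cong) auto
    qed
    moreover have "A * B - B * A \<in> carrier_mat n n" using c by auto
    ultimately show ?case by (blast intro: suI)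
  qed
qed

section \<open>Complexification of the generated algebra\<close>

definition lie_gen_complex :: "nat \<Rightarrow> complex mat set \<Rightarrow> (nat \<Rightarrow> nat \<Rightarrow> complex) set" where
  "lie_gen_complex n S = {f. \<exists>B\<in>lie_gen n S. \<exists>C\<in>lie_gen n S.
     \<forall>a<n. \<forall>b<n. f a b = B $$ (a, b) + \<i> * C $$ (a, b)}"

lemma lie_gen_complexI:
  assumes "B \<in> lie_gen n S" "C \<in> lie_gen n S"
    "\<And>a b. a < n \<Longrightarrow> b < n \<Longrightarrow> f a b = B $$ (a, b) + \<i> * C $$ (a, b)"
  shows "f \<in> lie_gen_complex n S"
  using assms unfolding lie_gen_complex_def by blast

lemma lie_gen_complexE:
  assumes "f \<in> lie_gen_complex n S"
  obtains B C where "B \<in> lie_gen n S" "C \<in> lie_gen n S"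
    "\<And>a b. a < n \<Longrightarrow> b < n \<Longrightarrow> f a b = B $$ (a, b) + \<i> * C $$ (a, b)"
  using assms unfolding lie_gen_complex_def by blast

text \<open>The component \<open>\<i> C\<close> of \<open>A\<close> is both Hermitian and skew-Hermitian, hence zero.\<close>
lemma su_lie_gen_complex:
  assumes S: "S \<subseteq> su n" and A: "A \<in> su n"
    and f: "(\<lambda>a b. A $$ (a, b)) \<in> lie_gen_complex n S"
  shows "A \<in> lie_gen n S"
proof -
  obtain B C where B: "B \<in> lie_gen n S" and C: "C \<in> lie_gen n S"
    and eq: "\<And>a b. a < n \<Longrightarrow> b < n \<Longrightarrow> A $$ (a, b) = B $$ (a, b) + \<i> * C $$ (a, b)"
    using f by (auto simp: lie_gen_complex_def)
  have BC: "B \<in> su n" "C \<in> su n"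
    using lie_gen_subset_su[OF S] B C by auto
  have "C $$ (a, b) = 0" if "a < n" "b < n" for a b
  proof -
    note skew = suD(2)[OF A that] suD(2)[OF BC(1) that] suD(2)[OF BC(2) that]
    have "\<i> * C $$ (a, b) = - cnj (A $$ (b, a)) + cnj (B $$ (b, a))"
      using eq[OF that] unfolding skew(1,2) by simp
    also have "\<dots> = \<i> * cnj (C $$ (b, a))"
      unfolding eq[OF that(2,1)] by simp
    also have "\<dots> = - \<i> * C $$ (a, b)"
      unfolding skew(3) by simp
    finally show ?thesis by simp
  qed
  then have "A = B"
    using suD(1)[OF A] suD(1)[OF BC(1)] eq by (intro eq_matI) auto
  then show ?thesis using B by simp
qed

section \<open>Matrix units and a criterion for containing \<open>sl n\<close>\<close>

definition matrix_unit :: "nat \<Rightarrow> nat \<Rightarrow> nat \<Rightarrow> nat \<Rightarrow> complex" where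
  "matrix_unit a b = (\<lambda>i j. of_bool (i = a \<and> j = b))"

lemma matrix_unit_mult:
  assumes "b < n"
  shows "(\<Sum>k<n. matrix_unit a b i k * matrix_unit c d k j) = of_bool (b = c) * matrix_unit a d i j"
proof -
  have "(\<Sum>k<n. matrix_unit a b i k * matrix_unit c d k j)
      = (\<Sum>k<n. if k = b then of_bool (b = c) * matrix_unit a d i j else 0)"
    by (intro sum.cong) (auto simp: matrix_unit_def)
  also have "\<dots> = of_bool (b = c) * matrix_unit a d i j"
    using assms by simp
  finally show ?thesis .
qed

text \<open>Elements are functions of two indices rather than matrices, which avoids dimension side
  conditions; by \<open>cong\<close> only the entries with both indices below \<open>n\<close>
  matter. The scalar in \<open>lin\<close> is complex, so one rule covers sums, differences and
  multiples.\<close>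

locale complex_lie_algebra =
  fixes n :: nat and L :: "(nat \<Rightarrow> nat \<Rightarrow> complex) set"
  assumes zero: "(\<lambda>a b. 0) \<in> L"
    and lin: "f \<in> L \<Longrightarrow> h \<in> L \<Longrightarrow> (\<lambda>a b. f a b + x * h a b) \<in> L"
    and brk: "f \<in> L \<Longrightarrow> h \<in> L \<Longrightarrow> (\<lambda>a b. \<Sum>k<n. f a k * h k b - h a k * f k b) \<in> L"
    and cong: "f \<in> L \<Longrightarrow> (\<And>a b. a < n \<Longrightarrow> b < n \<Longrightarrow> f a b = h a b) \<Longrightarrow> h \<in> L"

lemma complex_lie_algebra_lie_gen_complex:
  assumes S: "S \<subseteq> carrier_mat n n"
  shows "complex_lie_algebra n (lie_gen_complex n S)"
proof
  show "(\<lambda>a b. 0) \<in> lie_gen_complex n S"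
    by (rule lie_gen_complexI[OF lie_gen.zero lie_gen.zero]) simp
next
  fix f h and x :: complex
  assume fh: "f \<in> lie_gen_complex n S" "h \<in> lie_gen_complex n S"
  obtain B C where BC: "B \<in> lie_gen n S" "C \<in> lie_gen n S"
    and f: "\<And>a b. a < n \<Longrightarrow> b < n \<Longrightarrow> f a b = B $$ (a, b) + \<i> * C $$ (a, b)"
    using fh(1) by (rule lie_gen_complexE) (rule that)
  obtain B' C' where BC': "B' \<in> lie_gen n S" "C' \<in> lie_gen n S"
    and h: "\<And>a b. a < n \<Longrightarrow> b < n \<Longrightarrow> h a b = B' $$ (a, b) + \<i> * C' $$ (a, b)"
    using fh(2) by (rule lie_gen_complexE) (rule that)
  note mem = BC BC'
  note car = mem[THEN lie_gen_carrier[OF S]]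
  show "(\<lambda>a b. f a b + x * h a b) \<in> lie_gen_complex n S"
  proof -
    \<comment> \<open>The two components of \<open>(B + i C) + x (B' + i C')\<close>, with
      \<open>x\<close> split into real and imaginary part.\<close>
    let ?U = "B + (complex_of_real (Re x) \<cdot>\<^sub>m B' + complex_of_real (- Im x) \<cdot>\<^sub>m C')"
    let ?V = "C + (complex_of_real (Im x) \<cdot>\<^sub>m B' + complex_of_real (Re x) \<cdot>\<^sub>m C')"
    have "?U \<in> lie_gen n S" "?V \<in> lie_gen n S"
      by (intro lie_gen.add lie_gen.smult mem)+
    moreover have "f a b + x * h a b = ?U $$ (a, b) + \<i> * ?V $$ (a, b)" if "a < n" "b < n" for a b
    proof -
      have "x = complex_of_real (Re x) + \<i> * complex_of_real (Im x)"
        by (rule complex_eq)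
      then have "f a b + x * h a b = B $$ (a, b) + \<i> * C $$ (a, b)
          + (complex_of_real (Re x) + \<i> * complex_of_real (Im x)) * (B' $$ (a, b) + \<i> * C' $$ (a, b))"
        using f h that by simp
      also have "\<dots> = ?U $$ (a, b) + \<i> * ?V $$ (a, b)"
        using that car by (simp add: algebra_simps)
      finally show ?thesis .
    qed
    ultimately show ?thesis
      by (rule lie_gen_complexI)
  qed
  show "(\<lambda>a b. \<Sum>k<n. f a k * h k b - h a k * f k b) \<in> lie_gen_complex n S"
  proof -
    let ?b = "\<lambda>X Y. X * Y - Y * X :: complex mat"
    \<comment> \<open>Bilinearity: \<open>[B + i C, B' + i C'] = ([B, B'] - [C, C']) + i ([B, C'] +
      [C, B'])\<close>.\<close>
    let ?U = "?b B B' + complex_of_real (-1) \<cdot>\<^sub>m ?b C C'"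
    let ?V = "?b B C' + ?b C B'"
    have "?U \<in> lie_gen n S" "?V \<in> lie_gen n S"
      by (intro lie_gen.add lie_gen.smult lie_gen.bracket mem)+
    moreover have "(\<Sum>k<n. f a k * h k b - h a k * f k b) = ?U $$ (a, b) + \<i> * ?V $$ (a, b)"
      if ab: "a < n" "b < n" for a b
    proof -
      have U: "?U $$ (a, b) = ?b B B' $$ (a, b) - ?b C C' $$ (a, b)"
        using ab car by simp
      have V: "?V $$ (a, b) = ?b B C' $$ (a, b) + ?b C B' $$ (a, b)"
        using ab car by simp
      show ?thesis
        unfolding U V bracket_entry[OF car(1,3) ab] bracket_entry[OF car(2,4) ab]
          bracket_entry[OF car(1,4) ab] bracket_entry[OF car(2,3) ab]
          sum_subtractf[symmetric] sum.distrib[symmetric] sum_distrib_left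
        by (intro sum.cong) (use ab in \<open>simp_all add: f h algebra_simps\<close>)
    qed
    ultimately show ?thesis
      by (rule lie_gen_complexI)
  qed
next
  fix f h
  assume "f \<in> lie_gen_complex n S" and fh: "\<And>a b. a < n \<Longrightarrow> b < n \<Longrightarrow> f a b = h a b"
  from this(1) obtain B C where "B \<in> lie_gen n S" "C \<in> lie_gen n S"
    and f: "\<And>a b. a < n \<Longrightarrow> b < n \<Longrightarrow> f a b = B $$ (a, b) + \<i> * C $$ (a, b)"
    by (rule lie_gen_complexE) (rule that)
  then show "h \<in> lie_gen_complex n S"
    using fh[symmetric] by (intro lie_gen_complexI) (simp_all add: f)
qed

context complex_lie_algebra
begin

lemma smult: "f \<in> L \<Longrightarrow> (\<lambda>a b. x * f a b) \<in> L"
  using lin[OF zero, of f x] by simp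

lemma smult_cancel: "(\<lambda>a b. x * f a b) \<in> L \<Longrightarrow> x \<noteq> 0 \<Longrightarrow> f \<in> L"
  using smult[of "\<lambda>a b. x * f a b" "inverse x"] by (simp add: mult.assoc[symmetric])

lemma sum_mem:
  "(\<And>t. t \<in> I \<Longrightarrow> f t \<in> L) \<Longrightarrow> (\<lambda>a b. \<Sum>t\<in>I. f t a b) \<in> L"
proof (induction I rule: infinite_finite_induct)
  case (insert x F)
  then show ?case using lin[of "f x" "\<lambda>a b. \<Sum>t\<in>F. f t a b" 1] by simp
qed (auto simp: zero)

text \<open>For \<open>a \<noteq> c\<close> this composes two off-diagonal units; for
  \<open>a = c\<close> it produces the traceless diagonal elements.\<close>

lemma matrix_unit_bracket:
  assumes "matrix_unit a b \<in> L" "matrix_unit b c \<in> L" "b < n" "c < n"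
  shows "(\<lambda>i j. matrix_unit a c i j - of_bool (a = c) * matrix_unit b b i j) \<in> L"
  by (rule cong[OF brk[OF assms(1,2)]]) (auto simp: sum_subtractf matrix_unit_mult assms)

text \<open>Reflexivity is put in by hand, since a diagonal unit has trace one and so lies outside
  \<open>sl n\<close>. With it, the relation is an equivalence on the indices below
  \<open>n\<close>.\<close>

definition linked :: "nat \<Rightarrow> nat \<Rightarrow> bool" where
  "linked a b \<longleftrightarrow> a = b \<or> matrix_unit a b \<in> L \<and> matrix_unit b a \<in> L"

lemma linked_sym: "linked a b \<Longrightarrow> linked b a"
  by (auto simp: linked_def)

lemma linked_trans:
  assumes "linked a b" "linked b c" "a < n" "b < n" "c < n"
  shows "linked a c"
  using assms matrix_unit_bracket[of a b c] matrix_unit_bracket[of c b a]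
  by (cases "a = c") (auto simp: linked_def)

text \<open>Links through index 0 yield all off-diagonal units, and brackets of opposite ones yield
  the differences \<open>D a\<close> of diagonal units. Together these span
  \<open>sl n\<close>.\<close>

lemma traceless_mem:
  assumes linked: "\<And>a. a < n \<Longrightarrow> linked a 0"
    and tr: "(\<Sum>a<n. f a a) = 0"
  shows "f \<in> L"
proof (cases "n = 0")
  case True
  then show ?thesis by (intro cong[OF zero]) auto
next
  case False
  have off: "matrix_unit a b \<in> L" if "a < n" "b < n" "a \<noteq> b" for a b
    using linked_trans[OF linked[of a] linked_sym[OF linked[of b]]] that False
    by (auto simp: linked_def)
  define D where "D a = (\<lambda>i j. matrix_unit a a i j - matrix_unit 0 0 i j)" for a
  have D: "D a \<in> L" if "a < n" for a
  proof (cases "a = 0")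
    case True
    then show ?thesis by (simp add: D_def zero)
  next
    case 0: False
    show ?thesis
      using matrix_unit_bracket[OF off[of a 0] off[of 0 a]] that 0 False by (simp add: D_def)
  qed
  have "(\<lambda>i j. \<Sum>a<n. \<Sum>b<n. f a b * (if a = b then D a i j else matrix_unit a b i j)) \<in> L"
  proof (rule sum_mem, rule sum_mem, rule smult)
    fix a b assume "a \<in> {..<n}" "b \<in> {..<n}"
    then show "(\<lambda>i j. if a = b then D a i j else matrix_unit a b i j) \<in> L"
      using D[of a] off[of a b] by (cases "a = b") auto
  qed
  then show ?thesis
  proof (rule cong)
    fix i j assume ij: "i < n" "j < n"
    \<comment> \<open>Each diagonal coefficient also contributes to the entry at (0, 0), with a
      minus sign; the total of these contributions is the trace of \<open>f\<close>, which
      vanishes.\<close>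
    have "(\<Sum>a<n. \<Sum>b<n. f a b * (if a = b then D a i j else matrix_unit a b i j))
        = (\<Sum>a<n. \<Sum>b<n. f a b * matrix_unit a b i j - (if b = a then f a a * matrix_unit 0 0 i j else 0))"
      by (intro sum.cong) (auto simp: D_def algebra_simps)
    also have "\<dots> = (\<Sum>a<n. \<Sum>b<n. f a b * matrix_unit a b i j) - (\<Sum>a<n. f a a) * matrix_unit 0 0 i j"
      by (simp add: sum_subtractf sum_distrib_right)
    also have "(\<Sum>a<n. \<Sum>b<n. f a b * matrix_unit a b i j)
        = (\<Sum>a<n. \<Sum>b<n. if b = j then if a = i then f i j else 0 else 0)"
      by (intro sum.cong) (auto simp: matrix_unit_def)
    also have "\<dots> = f i j"
      using ij by simp
    finally show "(\<Sum>a<n. \<Sum>b<n. f a b * (if a = b then D a i j else matrix_unit a b i j)) = f i j"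
      using tr by simp
  qed
qed

end

section \<open>Tensor products of qubit operators\<close>

text \<open>Booleans as indices let the entry of a tensor factor be read off directly from binary
  digits \<open>bit a i\<close>.\<close>

type_synonym op2 = "bool \<Rightarrow> bool \<Rightarrow> complex"

definition op2_mult :: "op2 \<Rightarrow> op2 \<Rightarrow> op2" (infixl "\<odot>" 70) where
  "P \<odot> Q = (\<lambda>a b. P a False * Q False b + P a True * Q True b)"

definition op2_comm :: "op2 \<Rightarrow> op2 \<Rightarrow> op2" where
  "op2_comm P Q = (\<lambda>a b. (P \<odot> Q) a b - (Q \<odot> P) a b)"

definition traceless2 :: "op2 \<Rightarrow> bool" where
  "traceless2 P \<longleftrightarrow> P False False + P True True = 0"

fun pauli_op :: "pauli \<Rightarrow> op2" where
  "pauli_op P0 = (\<lambda>a b. of_bool (a = b))"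
| "pauli_op PX = (\<lambda>a b. of_bool (a \<noteq> b))"
| "pauli_op PY = (\<lambda>a b. if a = b then 0 else if a then \<i> else - \<i>)"
| "pauli_op PZ = (\<lambda>a b. if a = b then if a then - 1 else 1 else 0)"

declare pauli_op.simps [simp del]

lemma op2_ext:
  "P = Q \<longleftrightarrow> P False False = Q False False \<and> P False True = Q False True
    \<and> P True False = Q True False \<and> P True True = (Q True True :: complex)"
  by (auto simp: fun_eq_iff all_bool_eq)

lemma pauli_one_mult [simp]: "pauli_op P0 \<odot> P = P" "P \<odot> pauli_op P0 = P"
  by (simp_all add: op2_ext op2_mult_def pauli_op.simps)

lemma pauli_square [simp]: "pauli_op p \<odot> pauli_op p = pauli_op P0"
  by (cases p) (simp_all add: op2_ext op2_mult_def pauli_op.simps)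

lemma op2_mult_assoc: "P \<odot> Q \<odot> R = P \<odot> (Q \<odot> R)"
  by (simp add: op2_ext op2_mult_def algebra_simps)

text \<open>Distinct nontrivial Pauli matrices anticommute and square to 1, so
  \<open>[p, q] = 2 p q\<close> and \<open>[p, [p, q]] = 4 q\<close>. In the other cases the inner
  commutator is already zero.\<close>

lemma op2_double_comm_pauli:
  assumes "p \<noteq> P0"
  shows "op2_comm (pauli_op p) (op2_comm (pauli_op p) (pauli_op q))
    = (\<lambda>a b. (if q \<in> {P0, p} then 0 else 4) * pauli_op q a b)"
  using assms by (cases p; cases q) (simp_all add: op2_ext op2_comm_def op2_mult_def pauli_op.simps)

lemma traceless2_pauli: "traceless2 (pauli_op p) \<longleftrightarrow> p \<noteq> P0"
  by (cases p) (simp_all add: traceless2_def pauli_op.simps)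

lemma traceless2_expand:
  assumes "traceless2 P"
  shows "P = (\<lambda>a b. (P False True + P True False) / 2 * pauli_op PX a b
    + (\<i> * (P False True - P True False) / 2 * pauli_op PY a b + P False False * pauli_op PZ a b))"
  using assms by (simp add: op2_ext pauli_op.simps traceless2_def field_simps eq_neg_iff_add_eq_0)

text \<open>Splits off the trace part. The factor \<open>1 *\<close> gives the sum the shape of
  \<open>tens_upd_lin\<close>.\<close>

lemma op2_expand:
  obtains x Q where "traceless2 Q" "P = (\<lambda>a b. x * pauli_op P0 a b + 1 * Q a b)"
proof
  let ?x = "(P False False + P True True) / 2"
  show "P = (\<lambda>a b. ?x * pauli_op P0 a b + 1 * (P a b - ?x * pauli_op P0 a b))"
    by auto
  show "traceless2 (\<lambda>a b. P a b - ?x * pauli_op P0 a b)"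
    by (simp add: traceless2_def pauli_op.simps field_simps)
qed

section \<open>Binary digits of basis indices and products of qubit operators\<close>

lemma bit_add_mult_two_power:
  fixes p :: nat
  assumes "i < M"
  shows "bit (s * 2^M + p) i = bit p i"
proof -
  have "take_bit M (s * 2^M + p) = take_bit M p"
    by (simp add: take_bit_eq_mod)
  then show ?thesis using assms by (metis bit_take_bit_iff)
qed

lemma bit_mod_two_power: "i < M \<Longrightarrow> bit (a mod 2^M :: nat) i = bit a i"
  by (simp add: bit_take_bit_iff flip: take_bit_eq_mod)

lemma all_bits_eq_iff:
  fixes a b :: nat
  shows "(\<forall>i<M. bit a i = bit b i) \<longleftrightarrow> a mod 2^M = b mod 2^M"
proof
  assume "\<forall>i<M. bit a i = bit b i"
  then have "take_bit M a = take_bit M b"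
    by (intro bit_eqI) (auto simp: bit_take_bit_iff)
  then show "a mod 2^M = b mod 2^M" by (simp add: take_bit_eq_mod)
next
  assume "a mod 2^M = b mod 2^M"
  then show "\<forall>i<M. bit a i = bit b i" using bit_mod_two_power by metis
qed

lemma prod_of_bool: "(\<Prod>i<m. of_bool (Q i)) = (of_bool (\<forall>i<m. Q i) :: 'a :: comm_semiring_1)" for m :: nat
  by (induction m) (auto simp: less_Suc_eq)

lemma sum_lessThan_mult:
  "(\<Sum>k<N*m. f k) = (\<Sum>s<N. \<Sum>p<m. f (s * m + p :: nat) :: 'a :: comm_monoid_add)"
proof -
  have shift: "sum f {s * m..<s * m + m} = (\<Sum>p<m. f (s * m + p))" for s
    using sum.shift_bounds_nat_ivl[of f 0 "s * m" m]
    by (simp add: lessThan_atLeast0 add.commute)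
  have "(\<Sum>k<N*m. f k) = (\<Sum>s<N. sum f {s * m..<s * m + m})"
    by (simp add: sum.nat_group)
  then show ?thesis by (simp add: shift)
qed

text \<open>The numbers below \<open>2^M\<close> run through all assignments of \<open>M\<close>
  digits, so this is the distributive law. The induction splits off the top digit
  \<open>s\<close>.\<close>

lemma sum_prod_bits:
  fixes f :: "nat \<Rightarrow> bool \<Rightarrow> 'a :: comm_semiring_1"
  shows "(\<Sum>p<2^M. \<Prod>i<M. f i (bit (p::nat) i)) = (\<Prod>i<M. f i False + f i True)"
proof (induction M)
  case (Suc M)
  have top: "\<not> bit p M" "bit (2^M + p) M" if "p < 2^M" for p :: nat
    using that by (simp_all add: bit_iff_odd)
  have "(\<Sum>p<2^Suc M. \<Prod>i<Suc M. f i (bit (p::nat) i))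
      = (\<Sum>s<2. \<Sum>p<2^M. \<Prod>i<Suc M. f i (bit (s * 2^M + p :: nat) i))"
    unfolding power_Suc by (rule sum_lessThan_mult)
  also have "\<dots> = (\<Sum>s<2. \<Sum>p<2^M. (\<Prod>i<M. f i (bit (p::nat) i)) * f M (s = (1::nat)))"
    by (intro sum.cong refl) (auto simp: bit_add_mult_two_power top less_2_cases_iff)
  finally show ?case
    by (simp add: Suc.IH[symmetric] sum_distrib_right[symmetric] distrib_left numeral_2_eq_2)
qed simp

text \<open>An entry of the tensor product of \<open>M\<close> factors. Only the lowest
  \<open>M\<close> digits are read, so indices of the whole space need not be reduced modulo
  \<open>2^M\<close>.\<close>

definition qubits :: "nat \<Rightarrow> (nat \<Rightarrow> op2) \<Rightarrow> nat \<Rightarrow> nat \<Rightarrow> complex" where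
  "qubits M B a b = (\<Prod>i<M. B i (bit a i) (bit b i))"

lemma qubits_mult: "(\<Sum>k<2^M. qubits M B a k * qubits M C k b) = qubits M (\<lambda>i. B i \<odot> C i) a b"
  unfolding qubits_def prod.distrib[symmetric]
  by (subst sum_prod_bits[where f = "\<lambda>i c. B i (bit a i) c * C i c (bit b i)"])
    (simp add: op2_mult_def)

lemma qubits_cong:
  "(\<And>i. i < M \<Longrightarrow> B i = C i) \<Longrightarrow> qubits M B a b = qubits M C a b"
  by (simp add: qubits_def)

text \<open>Isolates one factor; linearity in that factor follows from it.\<close>

lemma qubits_upd:
  assumes "k < M"
  shows "qubits M (B(k := P)) a b = P (bit a k) (bit b k) * (\<Prod>i\<in>{..<M}-{k}. B i (bit a i) (bit b i))"
proof -
  have "qubits M (B(k := P)) a b = (B(k := P)) k (bit a k) (bit b k)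
      * (\<Prod>i\<in>{..<M}-{k}. (B(k := P)) i (bit a i) (bit b i))"
    unfolding qubits_def using assms by (subst prod.remove[of _ k]) auto
  moreover have "(\<Prod>i\<in>{..<M}-{k}. (B(k := P)) i (bit a i) (bit b i))
      = (\<Prod>i\<in>{..<M}-{k}. B i (bit a i) (bit b i))"
    by (intro prod.cong) auto
  ultimately show ?thesis by simp
qed

lemma qubits_upd_lin:
  assumes "k < M"
  shows "qubits M (B(k := \<lambda>a b. x * P a b + y * Q a b)) a b
    = x * qubits M (B(k := P)) a b + y * qubits M (B(k := Q)) a b"
  by (simp add: qubits_upd[OF assms] algebra_simps)

lemma qubits_upd_smult:
  assumes "k < M"
  shows "qubits M (B(k := \<lambda>a b. x * P a b)) a b = x * qubits M (B(k := P)) a b"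
  by (simp add: qubits_upd[OF assms] algebra_simps)

lemma qubits_one: "qubits M (\<lambda>_. pauli_op P0) a b = of_bool (a mod 2^M = b mod 2^M)"
  unfolding qubits_def pauli_op.simps prod_of_bool all_bits_eq_iff ..

section \<open>Tensors of a system operator with qubit operators\<close>

definition sys_mult :: "nat \<Rightarrow> (nat \<Rightarrow> nat \<Rightarrow> complex) \<Rightarrow> (nat \<Rightarrow> nat \<Rightarrow> complex) \<Rightarrow> nat \<Rightarrow> nat \<Rightarrow> complex" where
  "sys_mult N A A' = (\<lambda>s t. \<Sum>u<N. A s u * A' u t)"

definition sys_one :: "nat \<Rightarrow> nat \<Rightarrow> complex" where
  "sys_one = (\<lambda>s t. of_bool (s = t))"

text \<open>Qubit \<open>i\<close> is addressed by the binary digit of weight \<open>2^i\<close>, so it is the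
  \<open>(M - i)\<close>-th factor of the Kronecker product.\<close>
definition tens :: "nat \<Rightarrow> (nat \<Rightarrow> nat \<Rightarrow> complex) \<Rightarrow> (nat \<Rightarrow> op2) \<Rightarrow> nat \<Rightarrow> nat \<Rightarrow> complex" where
  "tens M A B a b = A (a div 2^M) (b div 2^M) * qubits M B a b"

text \<open>Mixed-product rule: the intermediate index is \<open>s * 2^M + p\<close>, and the sum
  separates into the system index \<open>s\<close> and the qubit index \<open>p\<close>.\<close>

lemma tens_mult:
  "(\<Sum>k<N * 2^M. tens M A B a k * tens M A' B' k b) = tens M (sys_mult N A A') (\<lambda>i. B i \<odot> B' i) a b"
proof -
  have q: "qubits M B a (s * 2^M + p) = qubits M B a p"
    "qubits M B' (s * 2^M + p) b = qubits M B' p b" for s p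
    by (simp_all add: qubits_def bit_add_mult_two_power)
  have "(\<Sum>k<N * 2^M. tens M A B a k * tens M A' B' k b)
    = (\<Sum>s<N. \<Sum>p<2^M. (A (a div 2^M) s * A' s (b div 2^M)) * (qubits M B a p * qubits M B' p b))"
    unfolding sum_lessThan_mult by (intro sum.cong refl) (auto simp: tens_def q mult_ac)
  also have "\<dots> = tens M (sys_mult N A A') (\<lambda>i. B i \<odot> B' i) a b"
    by (simp add: sum_distrib_left[symmetric] qubits_mult tens_def sys_mult_def sum_distrib_right)
  finally show ?thesis .
qed

lemma tens_cong:
  assumes "\<And>s t. s < N \<Longrightarrow> t < N \<Longrightarrow> A s t = A' s t" "\<And>i. i < M \<Longrightarrow> B i = B' i"
    "a < N * 2^M" "b < N * 2^M"
  shows "tens M A B a b = tens M A' B' a b"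
  using assms by (simp add: tens_def less_mult_imp_div_less cong: qubits_cong)

lemma sys_mult_one:
  assumes "s < N" "t < N"
  shows "sys_mult N sys_one A s t = A s t" "sys_mult N A sys_one s t = A s t"
  using assms by (simp_all add: sys_mult_def sys_one_def of_bool_def if_distrib if_distribR cong: if_cong)

section \<open>Lie algebras of tensors and commutators with one-qubit operators\<close>

locale qubit_lie_algebra = complex_lie_algebra "N * 2^M" L for N M L
begin

lemma tens_mem_cong:
  assumes "tens M A B \<in> L" "\<And>s t. s < N \<Longrightarrow> t < N \<Longrightarrow> A s t = A' s t" "\<And>i. i < M \<Longrightarrow> B i = B' i"
  shows "tens M A' B' \<in> L"
  using assms(1) by (rule cong) (rule tens_cong[OF assms(2,3)])

lemma tens_bracket:
  assumes "tens M A B \<in> L" "tens M A' B' \<in> L"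
  shows "(\<lambda>a b. tens M (sys_mult N A A') (\<lambda>i. B i \<odot> B' i) a b
    - tens M (sys_mult N A' A) (\<lambda>i. B' i \<odot> B i) a b) \<in> L"
  using brk[OF assms] by (simp add: sum_subtractf tens_mult)

lemma tens_upd_lin:
  assumes "k < M" "tens M A (B(k := P)) \<in> L" "tens M A (B(k := Q)) \<in> L"
  shows "tens M A (B(k := \<lambda>a b. x * P a b + y * Q a b)) \<in> L"
  by (rule cong[OF lin[OF smult[of _ x] , of _ _ y, OF assms(2,3)]])
    (simp add: tens_def qubits_upd_lin[OF assms(1)] algebra_simps)

abbreviation site :: "nat \<Rightarrow> op2 \<Rightarrow> nat \<Rightarrow> nat \<Rightarrow> complex" where
  "site k P \<equiv> tens M sys_one ((\<lambda>_. pauli_op P0)(k := P))"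

lemma upd_comm: "k < M \<Longrightarrow> tens M A (B(k := op2_comm P Q)) a b
   = tens M A (B(k := P \<odot> Q)) a b - tens M A (B(k := Q \<odot> P)) a b"
  by (simp add: tens_def qubits_upd op2_comm_def algebra_simps)

text \<open>A one-qubit operator is the identity on the system and on the other qubits, so the
  commutator only changes factor \<open>k\<close>. The form with a sum is needed because at first
  only the whole Hamiltonian is known to lie in \<open>L\<close>, not its single terms.\<close>

lemma ad_site_sum:
  assumes k: "k < M" and "site k P \<in> L"
    and "(\<lambda>a b. \<Sum>t\<in>I. q t * tens M (A t) (B t) a b) \<in> L"
  shows "(\<lambda>a b. \<Sum>t\<in>I. q t * tens M (A t) ((B t)(k := op2_comm P (B t k))) a b) \<in> L"
  using brk[OF assms(2,3)]
proof (rule cong)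
  fix a b assume ab: "a < N * 2^M" "b < N * 2^M"
  have "(\<Sum>c<N * 2^M. site k P a c * (\<Sum>t\<in>I. q t * tens M (A t) (B t) c b)
      - (\<Sum>t\<in>I. q t * tens M (A t) (B t) a c) * site k P c b)
    = (\<Sum>c<N * 2^M. \<Sum>t\<in>I. q t * (site k P a c * tens M (A t) (B t) c b
      - tens M (A t) (B t) a c * site k P c b))"
    unfolding sum_distrib_left sum_distrib_right sum_subtractf[symmetric]
    by (simp add: algebra_simps)
  also have "\<dots> = (\<Sum>t\<in>I. q t * (\<Sum>c<N * 2^M. site k P a c * tens M (A t) (B t) c b
      - tens M (A t) (B t) a c * site k P c b))"
    by (subst sum.swap) (simp add: sum_distrib_left)
  also have "\<dots> = (\<Sum>t\<in>I. q t * tens M (A t) ((B t)(k := op2_comm P (B t k))) a b)"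
  proof (intro sum.cong refl arg_cong2[of _ _ _ _ "(*)"])
    fix t
    have "tens M (sys_mult N sys_one (A t)) (\<lambda>i. ((\<lambda>_. pauli_op P0)(k := P)) i \<odot> B t i) a b
        = tens M (A t) ((B t)(k := P \<odot> B t k)) a b"
      by (rule tens_cong[OF _ _ ab]) (auto simp: sys_mult_one)
    moreover have "tens M (sys_mult N (A t) sys_one) (\<lambda>i. B t i \<odot> ((\<lambda>_. pauli_op P0)(k := P)) i) a b
        = tens M (A t) ((B t)(k := B t k \<odot> P)) a b"
      by (rule tens_cong[OF _ _ ab]) (auto simp: sys_mult_one)
    ultimately show "(\<Sum>c<N * 2^M. site k P a c * tens M (A t) (B t) c b
      - tens M (A t) (B t) a c * site k P c b) = tens M (A t) ((B t)(k := op2_comm P (B t k))) a b"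
      by (simp add: sum_subtractf tens_mult upd_comm[OF k])
  qed
  finally show "(\<Sum>c<N * 2^M. site k P a c * (\<Sum>t\<in>I. q t * tens M (A t) (B t) c b)
      - (\<Sum>t\<in>I. q t * tens M (A t) (B t) a c) * site k P c b)
    = (\<Sum>t\<in>I. q t * tens M (A t) ((B t)(k := op2_comm P (B t k))) a b)" .
qed

lemma ad_site:
  assumes "k < M" "site k P \<in> L" "tens M A B \<in> L"
  shows "tens M A (B(k := op2_comm P (B k))) \<in> L"
  using ad_site_sum[OF assms(1,2), where I = "{()}" and q = "\<lambda>_. 1" and A = "\<lambda>_. A" and B = "\<lambda>_. B"] assms(3)
  by simp

end

section \<open>Consequences of local control\<close>

lemma sys_mult_matrix_unit:
  "b < N \<Longrightarrow> sys_mult N (matrix_unit a b) (matrix_unit c d) = (\<lambda>i j. of_bool (b = c) * matrix_unit a d i j)"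
  by (simp add: sys_mult_def matrix_unit_mult)

text \<open>Take for \<open>r\<close> the third Pauli matrix; \<open>x\<close> is then
  \<open>2 i\<close> or \<open>-2 i\<close>.\<close>

lemma pauli_comm:
  assumes "p \<noteq> P0" "q \<noteq> P0" "p \<noteq> q"
  obtains r x where "r \<noteq> P0" "x \<noteq> 0" "op2_comm (pauli_op r) (pauli_op p) = (\<lambda>a b. x * pauli_op q a b)"
proof -
  have "\<exists>r\<in>{PX, PY, PZ}. \<exists>x\<in>{2 * \<i>, - 2 * \<i>}.
      op2_comm (pauli_op r) (pauli_op p) = (\<lambda>a b. x * pauli_op q a b)"
    using assms
    by (cases p; cases q) (simp_all add: op2_ext op2_comm_def op2_mult_def pauli_op.simps mult.assoc)
  then obtain r x where "r \<in> {PX, PY, PZ}" "x \<in> {2 * \<i>, - 2 * \<i>}"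
    "op2_comm (pauli_op r) (pauli_op p) = (\<lambda>a b. x * pauli_op q a b)"
    by blast
  then show ?thesis by (intro that[of r x]) auto
qed

context qubit_lie_algebra
begin

lemma tens_upd_smult_cancel:
  assumes "k < M" "x \<noteq> 0" "tens M A (B(k := \<lambda>a b. x * P a b)) \<in> L"
  shows "tens M A (B(k := P)) \<in> L"
proof (rule smult_cancel[OF _ assms(2)])
  show "(\<lambda>a b. x * tens M A (B(k := P)) a b) \<in> L"
    using assms(3) by (rule cong) (simp add: tens_def qubits_upd_smult[OF assms(1)])
qed

lemma tens_upd_traceless:
  assumes "k < M" "\<And>p. p \<noteq> P0 \<Longrightarrow> tens M A (B(k := pauli_op p)) \<in> L" "traceless2 P"
  shows "tens M A (B(k := P)) \<in> L"
proof -
  have "tens M A (B(k := \<lambda>a b. y * pauli_op PY a b + z * pauli_op PZ a b)) \<in> L" for y z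
    by (intro tens_upd_lin assms(1,2)) simp_all
  from tens_upd_lin[OF assms(1,2) this, of PX _ 1]
  have "tens M A (B(k := \<lambda>a b. x * pauli_op PX a b + (y * pauli_op PY a b + z * pauli_op PZ a b))) \<in> L" for x y z
    by simp
  then show ?thesis
    by (subst traceless2_expand[OF assms(3)])
qed

lemma tens_upd_all:
  assumes "k < M" "tens M A (B(k := pauli_op P0)) \<in> L"
    "\<And>P. traceless2 P \<Longrightarrow> tens M A (B(k := P)) \<in> L"
  shows "tens M A (B(k := P)) \<in> L"
proof -
  obtain x Q where "traceless2 Q" "P = (\<lambda>a b. x * pauli_op P0 a b + 1 * Q a b)"
    by (rule op2_expand)
  then show ?thesis
    using tens_upd_lin[OF assms(1,2) assms(3), of Q x 1] by simp
qed

text \<open>The hypotheses on the system parts say \<open>A A' A = A\<close>,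
  \<open>A' A A = 0\<close> and \<open>A A A' = 0\<close>, as holds for opposite off-diagonal matrix
  units. In the double commutator they kill two of the four products and leave
  \<open>BCD + DCB\<close> on the qubits.\<close>

lemma triple_product:
  assumes "tens M A B \<in> L" "tens M A' C \<in> L" "tens M A D \<in> L"
    and "\<And>s t. s < N \<Longrightarrow> t < N \<Longrightarrow> sys_mult N (sys_mult N A A') A s t = A s t"
    and "\<And>s t. s < N \<Longrightarrow> t < N \<Longrightarrow> sys_mult N A (sys_mult N A' A) s t = A s t"
    and "\<And>s t. s < N \<Longrightarrow> t < N \<Longrightarrow> sys_mult N (sys_mult N A' A) A s t = 0"
    and "\<And>s t. s < N \<Longrightarrow> t < N \<Longrightarrow> sys_mult N A (sys_mult N A A') s t = 0"
  shows "(\<lambda>a b. tens M A (\<lambda>i. B i \<odot> C i \<odot> D i) a b + tens M A (\<lambda>i. D i \<odot> C i \<odot> B i) a b) \<in> L"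
  using brk[OF tens_bracket[OF assms(1,2)] assms(3)]
proof (rule cong)
  fix a b assume ab: "a < N * 2^M" "b < N * 2^M"
  then have d: "a div 2^M < N" "b div 2^M < N"
    by (simp_all add: less_mult_imp_div_less)
  show "(\<Sum>k<N * 2^M. (tens M (sys_mult N A A') (\<lambda>i. B i \<odot> C i) a k
        - tens M (sys_mult N A' A) (\<lambda>i. C i \<odot> B i) a k) * tens M A D k b
      - tens M A D a k * (tens M (sys_mult N A A') (\<lambda>i. B i \<odot> C i) k b
        - tens M (sys_mult N A' A) (\<lambda>i. C i \<odot> B i) k b))
    = tens M A (\<lambda>i. B i \<odot> C i \<odot> D i) a b + tens M A (\<lambda>i. D i \<odot> C i \<odot> B i) a b"
    unfolding left_diff_distrib right_diff_distrib sum_subtractf tens_mult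
    by (simp add: tens_def assms(4-) d op2_mult_assoc)
qed

text \<open>A matrix unit of the whole space is a tensor of matrix units; the one on qubit
  \<open>i\<close> is selected by the digits of \<open>p\<close> and \<open>q\<close>.\<close>

lemma matrix_unit_mem:
  assumes "\<And>C. tens M (matrix_unit s t) C \<in> L" "p < 2^M" "q < 2^M"
  shows "matrix_unit (s * 2^M + p) (t * 2^M + q) \<in> L"
proof -
  have split: "a = s * 2^M + p \<longleftrightarrow> a div 2^M = s \<and> a mod 2^M = p" if "p < 2^M" for a s p :: nat
    using that div_mult_mod_eq[of a "2^M"] by auto
  have "tens M (matrix_unit s t) (\<lambda>i x y. of_bool (x = bit p i \<and> y = bit q i)) a b
      = matrix_unit (s * 2^M + p) (t * 2^M + q) a b" for a b
  proof -
    have "qubits M (\<lambda>i x y. of_bool (x = bit p i \<and> y = bit q i)) a b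
        = of_bool ((\<forall>i<M. bit a i = bit p i) \<and> (\<forall>i<M. bit b i = bit q i))"
      unfolding qubits_def prod_of_bool by (rule arg_cong[of _ _ of_bool]) blast
    then show ?thesis
      unfolding tens_def matrix_unit_def all_bits_eq_iff split[OF assms(2)] split[OF assms(3)]
      using assms(2,3) by auto
  qed
  then show ?thesis
    using cong[OF assms(1)] by blast
qed

end

section \<open>Filtering and rotating with local controls\<close>

locale controlled_lie_algebra = qubit_lie_algebra +
  assumes ctrl: "k < M \<Longrightarrow> site k (pauli_op PX) \<in> L" "k < M \<Longrightarrow> site k (pauli_op PY) \<in> L"
begin

text \<open>The commutator of X and Y supplies Z, and the three span \<open>sl 2\<close> on the
  qubit.\<close>

lemma site_mem:
  assumes "k < M" "traceless2 P"
  shows "site k P \<in> L"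
proof (rule tens_upd_traceless[OF assms(1) _ assms(2)])
  fix p assume "p \<noteq> P0"
  have "op2_comm (pauli_op PX) (pauli_op PY) = (\<lambda>a b. 2 * \<i> * pauli_op PZ a b)"
    by (simp add: op2_ext op2_comm_def op2_mult_def pauli_op.simps)
  then have "site k (pauli_op PZ) \<in> L"
    using tens_upd_smult_cancel[OF assms(1), of "2 * \<i>"] ad_site[OF assms(1) ctrl[OF assms(1)]]
    by simp
  then show "site k (pauli_op p) \<in> L"
    using ctrl assms(1) \<open>p \<noteq> P0\<close> by (cases p) auto
qed

lemma pauli_site_mem: "k < M \<Longrightarrow> p \<noteq> P0 \<Longrightarrow> site k (pauli_op p) \<in> L"
  by (simp add: site_mem traceless2_pauli)

text \<open>The double commutator with \<open>\<sigma>\<^sub>p\<close> on one qubit annihilates \<open>1\<close> and \<open>\<sigma>\<^sub>p\<close> there and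
  multiplies the other two Pauli matrices by 4.\<close>
lemma filter_site:
  assumes k: "k < M" "p \<noteq> P0" and I: "finite I"
    and mem: "(\<lambda>a b. \<Sum>t\<in>I. q t * tens M (A t) (\<lambda>i. pauli_op (l t i)) a b) \<in> L"
  shows "(\<lambda>a b. \<Sum>t\<in>{t\<in>I. l t k \<notin> {P0, p}}. q t * tens M (A t) (\<lambda>i. pauli_op (l t i)) a b) \<in> L"
proof (rule smult_cancel[where x = 4])
  note ad = ad_site_sum[OF k(1) pauli_site_mem[OF k]]
  show "(\<lambda>a b. 4 * (\<Sum>t\<in>{t\<in>I. l t k \<notin> {P0, p}}. q t * tens M (A t) (\<lambda>i. pauli_op (l t i)) a b)) \<in> L"
    using ad[OF ad[OF mem]]
  proof (rule cong)
    fix a b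
    have "tens M (A t) ((\<lambda>i. pauli_op (l t i))(k := \<lambda>a b. x * pauli_op (l t k) a b)) a b
        = x * tens M (A t) (\<lambda>i. pauli_op (l t i)) a b" for t x
    proof -
      have "(\<lambda>i. pauli_op (l t i))(k := pauli_op (l t k)) = (\<lambda>i. pauli_op (l t i))"
        by auto
      then show ?thesis by (simp add: tens_def qubits_upd_smult[OF k(1)])
    qed
    then show "(\<Sum>t\<in>I. q t * tens M (A t) (((\<lambda>i. pauli_op (l t i))
        (k := op2_comm (pauli_op p) (pauli_op (l t k))))
          (k := op2_comm (pauli_op p) (((\<lambda>i. pauli_op (l t i))
             (k := op2_comm (pauli_op p) (pauli_op (l t k)))) k))) a b)
      = 4 * (\<Sum>t\<in>{t\<in>I. l t k \<notin> {P0, p}}. q t * tens M (A t) (\<lambda>i. pauli_op (l t i)) a b)"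
      unfolding sum.inter_filter[OF I] sum_distrib_left
      by (intro sum.cong refl) (simp add: op2_double_comm_pauli[OF k(2)])
  qed
qed simp

text \<open>A filter selects terms without changing them once the factor 4 is cancelled, so filters
  on several qubits can be iterated.\<close>

lemma filter_sites:
  assumes "finite D" "D \<subseteq> {..<M}" "\<And>i. r i \<noteq> P0" and I: "finite I"
    and mem: "(\<lambda>a b. \<Sum>t\<in>I. q t * tens M (A t) (\<lambda>i. pauli_op (l t i)) a b) \<in> L"
  shows "(\<lambda>a b. \<Sum>t\<in>{t\<in>I. \<forall>i\<in>D. l t i \<notin> {P0, r i}}. q t * tens M (A t) (\<lambda>i. pauli_op (l t i)) a b) \<in> L"
  using assms(1,2)
proof (induction D)
  case empty
  then show ?case using mem by simp
next
  case (insert k D)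
  have "{t\<in>I. \<forall>i\<in>insert k D. l t i \<notin> {P0, r i}}
      = {t\<in>{t\<in>I. \<forall>i\<in>D. l t i \<notin> {P0, r i}}. l t k \<notin> {P0, r k}}"
    by auto
  then show ?case
    using filter_site[of k "r k" "{t\<in>I. \<forall>i\<in>D. l t i \<notin> {P0, r i}}"] insert I assms(3) by simp
qed

lemma rotate_site:
  assumes k: "k < M" "B k = pauli_op p" "p \<noteq> P0" and mem: "tens M A B \<in> L" and P: "traceless2 P"
  shows "tens M A (B(k := P)) \<in> L"
proof (rule tens_upd_traceless[OF k(1) _ P])
  fix q assume q: "q \<noteq> P0"
  show "tens M A (B(k := pauli_op q)) \<in> L"
  proof (cases "p = q")
    case True
    then have "B(k := pauli_op q) = B" using k by auto
    then show ?thesis using mem by simp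
  next
    case False
    obtain r x where r: "r \<noteq> P0" "x \<noteq> 0" "op2_comm (pauli_op r) (pauli_op p) = (\<lambda>a b. x * pauli_op q a b)"
      using pauli_comm[OF k(3) q False] by metis
    then show ?thesis
      using tens_upd_smult_cancel[OF k(1) r(2)] ad_site[OF k(1) pauli_site_mem[OF k(1) r(1)] mem] k(2)
      by simp
  qed
qed

lemma rotate_all:
  assumes l: "\<And>i. i < M \<Longrightarrow> l i \<noteq> P0" and mem: "tens M A (\<lambda>i. pauli_op (l i)) \<in> L"
    and C: "\<And>i. i < M \<Longrightarrow> traceless2 (C i)"
  shows "tens M A C \<in> L"
proof -
  \<comment> \<open>Induction on the number \<open>m\<close> of qubits whose factor has already been
    replaced.\<close>
  have "tens M A (\<lambda>i. if i < m then C i else pauli_op (l i)) \<in> L" if "m \<le> M" for m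
    using that
  proof (induction m)
    case 0
    then show ?case using mem by simp
  next
    case (Suc m)
    have "tens M A ((\<lambda>i. if i < m then C i else pauli_op (l i))(m := C m)) \<in> L"
      using Suc l C by (intro rotate_site[where p = "l m"]) auto
    moreover have "(\<lambda>i. if i < m then C i else pauli_op (l i))(m := C m)
        = (\<lambda>i. if i < Suc m then C i else pauli_op (l i))"
      by (auto simp: less_Suc_eq)
    ultimately show ?case by simp
  qed
  from this[of M] show ?thesis
    by (rule tens_mem_cong) auto
qed

section \<open>Two-qubit couplings and removal of the tracelessness restriction\<close>

definition pair_mem :: "nat \<Rightarrow> nat \<Rightarrow> bool" where
  "pair_mem k l \<longleftrightarrow> (\<forall>P Q. traceless2 P \<longrightarrow> traceless2 Q \<longrightarrow>
     tens M sys_one ((\<lambda>_. pauli_op P0)(k := P, l := Q)) \<in> L)"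

text \<open>Local rotations turn a single coupling of type XX into all products of traceless
  operators on the two qubits.\<close>

lemma pair_memI:
  assumes "k < M" "l < M" "k \<noteq> l"
    and "tens M sys_one ((\<lambda>_. pauli_op P0)(k := pauli_op PX, l := pauli_op PX)) \<in> L"
  shows "pair_mem k l"
  unfolding pair_mem_def
proof (intro allI impI)
  fix P Q assume P: "traceless2 P" and Q: "traceless2 Q"
  have "tens M sys_one (((\<lambda>_. pauli_op P0)(k := pauli_op PX, l := pauli_op PX))(k := P)) \<in> L"
    by (rule rotate_site[OF assms(1) _ _ assms(4) P]) (use assms in auto)
  then have "tens M sys_one ((\<lambda>_. pauli_op P0)(k := P, l := pauli_op PX)) \<in> L"
    using assms(3) by (simp add: fun_upd_twist)
  from rotate_site[OF assms(2) _ _ this Q, of PX]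
  show "tens M sys_one ((\<lambda>_. pauli_op P0)(k := P, l := Q)) \<in> L"
    by simp
qed

lemma pair_mem_sym: "k \<noteq> l \<Longrightarrow> pair_mem k l \<Longrightarrow> pair_mem l k"
  unfolding pair_mem_def by (metis fun_upd_twist)

text \<open>\<open>[1 \<otimes> Z\<^sub>k P\<^sub>l, A \<otimes> Z\<^sub>k S\<^sub>l] = A \<otimes> [P, S]\<^sub>l\<close> replaces the factor on qubit \<open>k\<close> by the
  identity at the price of keeping qubit \<open>l\<close> traceless.\<close>
lemma free_site:
  assumes kl: "k < M" "l < M" "k \<noteq> l" and pair: "pair_mem k l"
    and mem: "\<And>R S. traceless2 R \<Longrightarrow> traceless2 S \<Longrightarrow> tens M A (C(k := R, l := S)) \<in> L"
    and S: "traceless2 S"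
  shows "tens M A (C(k := R, l := S)) \<in> L"
proof (rule tens_upd_traceless[OF kl(2) _ S])
  fix q assume q: "q \<noteq> P0"
  show "tens M A (C(k := R, l := pauli_op q)) \<in> L"
    unfolding fun_upd_twist[OF kl(3)]
  proof (rule tens_upd_all[OF kl(1)])
    fix P assume "traceless2 P"
    then show "tens M A (C(l := pauli_op q, k := P)) \<in> L"
      using mem q by (simp add: fun_upd_twist[OF kl(3), symmetric] traceless2_pauli)
  next
    \<comment> \<open>\<open>p\<close> is an auxiliary factor different from \<open>q\<close>, and
      \<open>r\<close> turns it into \<open>q\<close> by a commutator on qubit \<open>l\<close>. The
      two factors Z on qubit \<open>k\<close> cancel in both products.\<close>
    obtain p where p: "p \<noteq> P0" "p \<noteq> q" by (cases q) auto
    obtain r x where r: "r \<noteq> P0" "x \<noteq> 0" "op2_comm (pauli_op r) (pauli_op p) = (\<lambda>a b. x * pauli_op q a b)"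
      using pauli_comm[OF p(1) q p(2)] by metis
    have "tens M sys_one ((\<lambda>_. pauli_op P0)(k := pauli_op PZ, l := pauli_op r)) \<in> L"
      using pair r unfolding pair_mem_def by (simp add: traceless2_pauli)
    moreover have "tens M A (C(k := pauli_op PZ, l := pauli_op p)) \<in> L"
      using mem p by (simp add: traceless2_pauli)
    ultimately have "tens M A (C(k := pauli_op P0, l := op2_comm (pauli_op r) (pauli_op p))) \<in> L"
    proof (rule cong[OF tens_bracket])
      fix a b assume ab: "a < N * 2^M" "b < N * 2^M"
      let ?U = "(\<lambda>_. pauli_op P0)(k := pauli_op PZ, l := pauli_op r)"
        and ?V = "C(k := pauli_op PZ, l := pauli_op p)"
      have "tens M (sys_mult N sys_one A) (\<lambda>i. ?U i \<odot> ?V i) a b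
          = tens M A (C(k := pauli_op P0, l := pauli_op r \<odot> pauli_op p)) a b"
        using kl(3) by (intro tens_cong[OF _ _ ab]) (auto simp: sys_mult_one)
      moreover have "tens M (sys_mult N A sys_one) (\<lambda>i. ?V i \<odot> ?U i) a b
          = tens M A (C(k := pauli_op P0, l := pauli_op p \<odot> pauli_op r)) a b"
        using kl(3) by (intro tens_cong[OF _ _ ab]) (auto simp: sys_mult_one)
      ultimately show "tens M (sys_mult N sys_one A) (\<lambda>i. ?U i \<odot> ?V i) a b
          - tens M (sys_mult N A sys_one) (\<lambda>i. ?V i \<odot> ?U i) a b
        = tens M A (C(k := pauli_op P0, l := op2_comm (pauli_op r) (pauli_op p))) a b"
        by (simp only: upd_comm[OF kl(2)])
    qed
    then show "tens M A (C(l := pauli_op q, k := pauli_op P0)) \<in> L"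
      using tens_upd_smult_cancel[OF kl(2) r(2)] r(3) by (simp add: fun_upd_twist[OF kl(3), symmetric])
  qed
qed

definition full_mem :: "(nat \<Rightarrow> nat \<Rightarrow> complex) \<Rightarrow> bool" where
  "full_mem A \<longleftrightarrow> (\<forall>C. (\<forall>i<M. traceless2 (C i)) \<longrightarrow> tens M A C \<in> L)"

text \<open>Induction on the number \<open>m\<close> of freed qubits: qubit \<open>m\<close> is
  freed with the help of its successor, which is not yet freed and hence still traceless.\<close>

lemma free_initial_sites:
  assumes A: "full_mem A" and pair: "\<And>k. Suc k < M \<Longrightarrow> pair_mem k (Suc k)"
    and "m < M" "\<forall>i<M. m \<le> i \<longrightarrow> traceless2 (C i)"
  shows "tens M A C \<in> L"
  using assms(3,4)
proof (induction m arbitrary: C)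
  case 0
  then show ?case using A by (simp add: full_mem_def)
next
  case (Suc m)
  have mem: "tens M A (C(m := R, Suc m := S)) \<in> L" if "traceless2 R" "traceless2 S" for R S
    using Suc.prems that by (intro Suc.IH) auto
  have "tens M A (C(m := C m, Suc m := C (Suc m))) \<in> L"
    by (rule free_site[OF _ _ _ pair mem]) (use Suc.prems in auto)
  then show ?case by simp
qed

text \<open>A traceless last factor is the final stage of the previous induction. If only the factor
  before it is traceless, the last qubit is freed by using the coupling in the opposite
  direction.\<close>

lemma free_sites:
  assumes A: "full_mem A" and pair: "\<And>k. Suc k < M \<Longrightarrow> pair_mem k (Suc k)"
    and M: "M = Suc (Suc v)" and C: "traceless2 (C (Suc v)) \<or> traceless2 (C v)"
  shows "tens M A C \<in> L"
proof -
  have W: "tens M A C \<in> L" if "traceless2 (C (Suc v))" for C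
    using that M by (intro free_initial_sites[OF A pair, of "Suc v"]) (auto simp: less_Suc_eq)
  show ?thesis
  proof (cases "traceless2 (C (Suc v))")
    case True
    then show ?thesis by (rule W)
  next
    case False
    have mem: "tens M A (C(Suc v := R, v := S)) \<in> L" if "traceless2 R" for R S
      using that by (intro W) simp
    have pr: "pair_mem (Suc v) v"
      by (rule pair_mem_sym[OF _ pair]) (simp_all add: M)
    have "tens M A (C(Suc v := C (Suc v), v := C v)) \<in> L"
      by (rule free_site[OF _ _ _ pr mem]) (use C False M in auto)
    then show ?thesis by simp
  qed
qed

text \<open>Freeing the qubits one after another with the help of a neighbour leaves only the tensors that
  are the identity on the last two qubits, and these are triple products.\<close>
lemma tens_mem_of_full_mem:
  assumes M: "M \<ge> 2" and pair: "\<And>k. Suc k < M \<Longrightarrow> pair_mem k (Suc k)"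
    and A: "full_mem (matrix_unit s t)" and A': "full_mem (matrix_unit t s)"
    and st: "s < N" "t < N" "s \<noteq> t"
  shows "tens M (matrix_unit s t) C \<in> L"
proof -
  obtain v where v: "M = Suc (Suc v)"
    using M by (metis add_2_eq_Suc le_Suc_ex)
  define u where "u = Suc v"
  have uv: "u < M" "v < M" "u \<noteq> v" using v by (auto simp: u_def)
  note free = free_sites[OF A pair v, folded u_def] and free' = free_sites[OF A' pair v, folded u_def]
  have id: "tens M (matrix_unit s t) (C(u := pauli_op P0, v := pauli_op P0)) \<in> L" for C
  proof -
    \<comment> \<open>Each of the three tensors has a Z on \<open>u\<close> or on \<open>v\<close>,
      hence is already available. On both qubits exactly two of the factors are Z, so both triple
      products are the identity there and equal \<open>C\<close> elsewhere.\<close>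
    let ?B = "C(u := pauli_op PZ, v := pauli_op PZ)"
    let ?C = "(\<lambda>_. pauli_op P0)(u := pauli_op PZ)" and ?D = "(\<lambda>_. pauli_op P0)(v := pauli_op PZ)"
    have "tens M (matrix_unit s t) ?B \<in> L" "tens M (matrix_unit t s) ?C \<in> L"
      "tens M (matrix_unit s t) ?D \<in> L"
      by (rule free free'; simp add: traceless2_pauli)+
    from triple_product[OF this]
    have "(\<lambda>a b. tens M (matrix_unit s t) (\<lambda>i. ?B i \<odot> ?C i \<odot> ?D i) a b
        + tens M (matrix_unit s t) (\<lambda>i. ?D i \<odot> ?C i \<odot> ?B i) a b) \<in> L"
      using st by (simp add: sys_mult_matrix_unit)
    moreover have "(\<lambda>i. ?B i \<odot> ?C i \<odot> ?D i) = C(u := pauli_op P0, v := pauli_op P0)"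
      "(\<lambda>i. ?D i \<odot> ?C i \<odot> ?B i) = C(u := pauli_op P0, v := pauli_op P0)"
      using uv(3) by (auto simp: fun_eq_iff)
    ultimately have "(\<lambda>a b. 2 * tens M (matrix_unit s t) (C(u := pauli_op P0, v := pauli_op P0)) a b) \<in> L"
      by simp
    then show ?thesis
      by (rule smult_cancel) simp
  qed
  \<comment> \<open>The factor on \<open>u\<close> is made arbitrary first, while \<open>v\<close>
    carries the identity; afterwards the factor on \<open>v\<close>.\<close>
  have "tens M (matrix_unit s t) (C(v := pauli_op P0, u := P)) \<in> L" for P
  proof (rule tens_upd_all[OF uv(1)])
    show "tens M (matrix_unit s t) (C(v := pauli_op P0, u := pauli_op P0)) \<in> L"
      using id[of C] uv(3) by (simp add: fun_upd_twist)
    show "tens M (matrix_unit s t) (C(v := pauli_op P0, u := P)) \<in> L" if "traceless2 P" for P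
      using that by (intro free) auto
  qed
  from this[of "C u"] have "tens M (matrix_unit s t) (C(v := pauli_op P0)) \<in> L"
    using uv(3) by (simp add: fun_upd_idem)
  then have "tens M (matrix_unit s t) (C(v := C v)) \<in> L"
    by (rule tens_upd_all[OF uv(2)]) (rule free, auto)
  then show ?thesis by simp
qed

text \<open>Ladder operators with arbitrary qubit part link every basis vector of a level to every
  one of the next level. Descending level by level links all of them to vector 0.\<close>

lemma traceless_mem_of_ladder:
  assumes M: "M \<ge> 2" and N: "N \<ge> 2" and pair: "\<And>k. Suc k < M \<Longrightarrow> pair_mem k (Suc k)"
    and up: "\<And>j. Suc j < N \<Longrightarrow> full_mem (matrix_unit j (Suc j))"
    and down: "\<And>j. Suc j < N \<Longrightarrow> full_mem (matrix_unit (Suc j) j)"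
    and tr: "(\<Sum>a<N * 2^M. f a a) = 0"
  shows "f \<in> L"
proof (rule traceless_mem)
  show "(\<Sum>a<N * 2^M. f a a) = 0" by (rule tr)
  have step: "linked (Suc j * 2^M + q) (j * 2^M + p)" if "Suc j < N" "p < 2^M" "q < 2^M" for j p q
  proof -
    have "tens M (matrix_unit j (Suc j)) C \<in> L" "tens M (matrix_unit (Suc j) j) C \<in> L" for C
      using tens_mem_of_full_mem[OF M pair up[OF that(1)] down[OF that(1)]]
        tens_mem_of_full_mem[OF M pair down[OF that(1)] up[OF that(1)]] that(1) by simp_all
    then show ?thesis
      using matrix_unit_mem[OF _ that(2,3)] matrix_unit_mem[OF _ that(3,2)] unfolding linked_def by blast
  qed
  have lt: "j * 2^M + p < N * 2^M" if "j < N" "p < 2^M" for j p :: nat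
  proof -
    have "j * 2^M + p < Suc j * 2^M" using that by simp
    also have "\<dots> \<le> N * 2^M" using that by (intro mult_right_mono) auto
    finally show ?thesis .
  qed
  have zero_lt: "0 < N * 2^M" using N by simp
  have linked0: "linked (j * 2^M + p) 0" if "j < N" "p < 2^M" for j p
    using that
  proof (induction j arbitrary: p)
    case 0
    \<comment> \<open>Two vectors of level 0 are not linked by a single ladder operator; the detour
      passes through level 1, which exists since \<open>N \<ge> 2\<close>.\<close>
    have "linked p (1 * 2^M + 0)" "linked (1 * 2^M + 0) 0"
      using step[of 0 p 0] step[of 0 0 0] N 0 by (auto intro: linked_sym)
    then show ?case
      using linked_trans[of p "1 * 2^M + 0" 0] lt[of 0 p] lt[of 1 0] zero_lt N 0 by simp
  next
    case (Suc j)
    show ?case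
    proof (rule linked_trans)
      show "linked (Suc j * 2^M + p) (j * 2^M + 0)" by (rule step) (use Suc.prems in auto)
      show "linked (j * 2^M + 0) 0" by (rule Suc.IH) (use Suc.prems in auto)
    qed (use Suc.prems zero_lt in \<open>auto intro!: lt simp del: mult_Suc add_0_right\<close>)
  qed
  show "linked a 0" if "a < N * 2^M" for a
    using linked0[of "a div 2^M" "a mod 2^M"] less_mult_imp_div_less[OF that]
    unfolding div_mult_mod_eq by simp
qed

end

section \<open>The Hamiltonian as a sum of Pauli tensors\<close>

lemma kron_carrier:
  "A \<in> carrier_mat m n \<Longrightarrow> B \<in> carrier_mat p q \<Longrightarrow> kron A B \<in> carrier_mat (m * p) (n * q)"
  by (auto simp: kron_def)

lemma pauli_mat_carrier: "pauli_mat p \<in> carrier_mat 2 2"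
  by (cases p) (simp_all add: pauli_mat_def)

lemma pauli_mat_entry: "pauli_mat p $$ (of_bool x, of_bool y) = pauli_op p x y"
  by (cases p; cases x; cases y) (simp_all add: pauli_mat_def pauli_op.simps)

lemma kron_entry:
  assumes "A \<in> carrier_mat m m" "B \<in> carrier_mat p p" "a < m * p" "b < m * p"
  shows "kron A B $$ (a, b) = A $$ (a div p, b div p) * B $$ (a mod p, b mod p)"
  using assms by (auto simp: kron_def)

lemma qubits_mod: "qubits M B (a mod 2^M) (b mod 2^M) = qubits M B a b"
  by (simp add: qubits_def bit_mod_two_power)

text \<open>The head of the list is the leftmost Kronecker factor and so acts on the most
  significant digit; hence the reversed list. The dimensions belong to the induction because
  \<open>kron\<close> splits indices by those of its right factor.\<close>

lemma pauli_string:
  "pauli_string as \<in> carrier_mat (2 ^ length as) (2 ^ length as) \<and>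
   (\<forall>a < 2 ^ length as. \<forall>b < 2 ^ length as.
     pauli_string as $$ (a, b) = qubits (length as) (\<lambda>i. pauli_op (rev as ! i)) a b)"
proof (induction as)
  case Nil
  then show ?case by (simp add: pauli_string_def qubits_def)
next
  case (Cons p as)
  let ?m = "length as"
  have eq: "pauli_string (p # as) = kron (pauli_mat p) (pauli_string as)"
    by (simp add: pauli_string_def)
  have bit: "a div 2 ^ ?m = of_bool (bit a ?m)" if "a < 2 * 2 ^ ?m" for a :: nat
  proof -
    have "a div 2 ^ ?m < 2" using that by (simp add: less_mult_imp_div_less)
    then show ?thesis by (auto simp: bit_iff_odd less_2_cases_iff)
  qed
  show ?case
  proof (intro conjI allI impI)
    show "pauli_string (p # as) \<in> carrier_mat (2 ^ length (p # as)) (2 ^ length (p # as))"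
      unfolding eq using kron_carrier[OF pauli_mat_carrier conjunct1[OF Cons.IH]] by simp
    fix a b :: nat assume ab: "a < 2 ^ length (p # as)" "b < 2 ^ length (p # as)"
    have "pauli_string (p # as) $$ (a, b)
        = pauli_op p (bit a ?m) (bit b ?m) * pauli_string as $$ (a mod 2 ^ ?m, b mod 2 ^ ?m)"
      unfolding eq using ab Cons.IH
      by (subst kron_entry[OF pauli_mat_carrier]) (auto simp: bit pauli_mat_entry)
    also have "pauli_string as $$ (a mod 2 ^ ?m, b mod 2 ^ ?m)
        = qubits ?m (\<lambda>i. pauli_op (rev as ! i)) a b"
      using Cons.IH by (simp add: qubits_mod)
    also have "pauli_op p (bit a ?m) (bit b ?m) * qubits ?m (\<lambda>i. pauli_op (rev as ! i)) a b
        = qubits (length (p # as)) (\<lambda>i. pauli_op (rev (p # as) ! i)) a b"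
      by (simp add: qubits_def nth_append mult.commute)
    finally show "pauli_string (p # as) $$ (a, b)
        = qubits (length (p # as)) (\<lambda>i. pauli_op (rev (p # as) ! i)) a b" .
  qed
qed

lemma sigma_on_carrier: "sigma_on M j p \<in> carrier_mat (2^M) (2^M)"
  using pauli_string[of "map (\<lambda>i. if i = j then p else P0) [1..<M+1]"]
  by (simp add: sigma_on_def del: upt_Suc)

text \<open>Qubits are counted from 1 on the left, digits from 0 on the right, so qubit
  \<open>j\<close> is digit \<open>M - j\<close>.\<close>

lemma sigma_on_entry:
  assumes "j \<in> {1..M}" "a < 2^M" "b < 2^M"
  shows "sigma_on M j p $$ (a, b) = qubits M (\<lambda>i. pauli_op (if i = M - j then p else P0)) a b"
proof -
  let ?as = "map (\<lambda>i. if i = j then p else P0) [1..<M+1]"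
  have "sigma_on M j p $$ (a, b) = qubits M (\<lambda>i. pauli_op (rev ?as ! i)) a b"
    using pauli_string[of ?as] assms by (simp add: sigma_on_def del: upt_Suc)
  also have "\<dots> = qubits M (\<lambda>i. pauli_op (if i = M - j then p else P0)) a b"
  proof (rule qubits_cong)
    fix i assume "i < M"
    then have "rev ?as ! i = (if M - i = j then p else P0)"
      by (simp add: rev_nth Suc_diff_Suc del: upt_Suc)
    also have "\<dots> = (if i = M - j then p else P0)"
      using \<open>i < M\<close> assms(1) by auto
    finally show "pauli_op (rev ?as ! i) = pauli_op (if i = M - j then p else P0)" by simp
  qed
  finally show ?thesis .
qed

lemma sigma_on_pair_entry:
  assumes "j \<in> {1..M-1}" "a < 2^M" "b < 2^M"
  shows "(sigma_on M j PX * sigma_on M (j+1) PX) $$ (a, b)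
    = qubits M (\<lambda>i. pauli_op (if i = M - j \<or> i = M - (j+1) then PX else P0)) a b"
proof -
  have "(sigma_on M j PX * sigma_on M (j+1) PX) $$ (a, b)
      = (\<Sum>k<2^M. sigma_on M j PX $$ (a, k) * sigma_on M (j+1) PX $$ (k, b))"
    using sigma_on_carrier[of M j PX] sigma_on_carrier[of M "j+1" PX] assms
    by (simp add: scalar_prod_def lessThan_atLeast0)
  also have "\<dots> = (\<Sum>k<2^M. qubits M (\<lambda>i. pauli_op (if i = M - j then PX else P0)) a k
      * qubits M (\<lambda>i. pauli_op (if i = M - (j+1) then PX else P0)) k b)"
  proof (intro sum.cong refl)
    fix k :: nat assume "k \<in> {..<2^M}"
    moreover have "j \<in> {1..M}" "j + 1 \<in> {1..M}" using assms(1) by auto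
    ultimately show "sigma_on M j PX $$ (a, k) * sigma_on M (j+1) PX $$ (k, b)
      = qubits M (\<lambda>i. pauli_op (if i = M - j then PX else P0)) a k
      * qubits M (\<lambda>i. pauli_op (if i = M - (j+1) then PX else P0)) k b"
      using assms(2,3) by (simp only: sigma_on_entry lessThan_iff)
  qed
  also have "\<dots> = qubits M (\<lambda>i. pauli_op (if i = M - j \<or> i = M - (j+1) then PX else P0)) a b"
    unfolding qubits_mult using assms by (intro qubits_cong) auto
  finally show ?thesis .
qed

lemma kron_tens:
  assumes "A \<in> carrier_mat N N" "P \<in> carrier_mat (2^M) (2^M)"
    and "\<And>a b. a < 2^M \<Longrightarrow> b < 2^M \<Longrightarrow> P $$ (a, b) = qubits M B a b"
    and "a < N * 2^M" "b < N * 2^M"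
  shows "kron A P $$ (a, b) = tens M (\<lambda>s t. A $$ (s, t)) B a b"
  using assms by (simp add: kron_entry tens_def qubits_mod)

text \<open>Names for the terms of the drift. \<open>System\<close> stands for \<open>H_S\<close>
  and \<open>H_ctrl_S\<close> together, as both are the identity on all qubits.\<close>

datatype ham_term = System | Zeeman nat | Coupling nat | Interaction nat nat "pauli list"

definition interaction_terms :: "nat \<Rightarrow> nat \<Rightarrow> ham_term set" where
  "interaction_terms N M = (\<lambda>(j, k, as). Interaction j k as) ` ({1..N-1} \<times> {1..2} \<times> xy_strings M)"

text \<open>The part outside \<open>H_SA\<close>: each of these terms acts on at most two
  qubits.\<close>

definition local_terms :: "nat \<Rightarrow> ham_term set" where
  "local_terms M = insert System (Zeeman ` {1..M} \<union> Coupling ` {1..M-1})"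

fun ham_labels :: "nat \<Rightarrow> ham_term \<Rightarrow> nat \<Rightarrow> pauli" where
  "ham_labels M System = (\<lambda>i. P0)"
| "ham_labels M (Zeeman j) = (\<lambda>i. if i = M - j then PZ else P0)"
| "ham_labels M (Coupling j) = (\<lambda>i. if i = M - j \<or> i = M - (j+1) then PX else P0)"
| "ham_labels M (Interaction j k as) = (\<lambda>i. rev as ! i)"

fun ham_coeff where
  "ham_coeff w c g System = (1::real)"
| "ham_coeff w c g (Zeeman j) = w j"
| "ham_coeff w c g (Coupling j) = c j"
| "ham_coeff w c g (Interaction j k as) = g j k as"

fun ham_system :: "nat \<Rightarrow> (nat \<Rightarrow> nat \<Rightarrow> complex) \<Rightarrow> ham_term \<Rightarrow> nat \<Rightarrow> nat \<Rightarrow> complex" where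
  "ham_system N K System = K"
| "ham_system N K (Interaction j k as) = (\<lambda>s t. s_mat N j k $$ (s, t))"
| "ham_system N K _ = sys_one"

abbreviation ham_tens where
  "ham_tens N M K t \<equiv> tens M (ham_system N K t) (\<lambda>i. pauli_op (ham_labels M t i))"

lemma finite_xy_strings: "finite (xy_strings M)"
proof -
  have "xy_strings M = {as. set as \<subseteq> {PX, PY} \<and> length as = M}"
    by (auto simp: xy_strings_def)
  then show ?thesis using finite_lists_length_eq[of "{PX, PY}" M] by simp
qed

lemma finite_terms: "finite (interaction_terms N M)" "finite (local_terms M)"
  using finite_xy_strings by (auto simp: interaction_terms_def local_terms_def)

lemma terms_disjoint: "local_terms M \<inter> interaction_terms N M = {}"
  by (auto simp: interaction_terms_def local_terms_def)

lemma sum_interaction_terms: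
  "(\<Sum>t\<in>interaction_terms N M. f t) = (\<Sum>(j, k, as)\<in>{1..N-1} \<times> {1..2} \<times> xy_strings M. f (Interaction j k as))"
  unfolding interaction_terms_def
  by (subst sum.reindex) (auto simp: inj_on_def case_prod_unfold)

lemma sum_local_terms:
  "(\<Sum>t\<in>local_terms M. f t) = f System + (\<Sum>j\<in>{1..M}. f (Zeeman j)) + (\<Sum>j\<in>{1..M-1}. f (Coupling j))"
proof -
  have "(\<Sum>t\<in>local_terms M. f t) = f System + (\<Sum>t\<in>Zeeman ` {1..M} \<union> Coupling ` {1..M-1}. f t)"
    unfolding local_terms_def by (subst sum.insert) auto
  also have "(\<Sum>t\<in>Zeeman ` {1..M} \<union> Coupling ` {1..M-1}. f t)
      = (\<Sum>t\<in>Zeeman ` {1..M}. f t) + (\<Sum>t\<in>Coupling ` {1..M-1}. f t)"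
    by (rule sum.union_disjoint) auto
  also have "(\<Sum>t\<in>Zeeman ` {1..M}. f t) = (\<Sum>j\<in>{1..M}. f (Zeeman j))"
    by (subst sum.reindex) (auto simp: inj_on_def)
  also have "(\<Sum>t\<in>Coupling ` {1..M-1}. f t) = (\<Sum>j\<in>{1..M-1}. f (Coupling j))"
    by (subst sum.reindex) (auto simp: inj_on_def)
  finally show ?thesis by (simp add: add.assoc)
qed

section \<open>Entries of the Hamiltonian\<close>

lemma msum_carrier [simp]: "msum n f I \<in> carrier_mat n n"
  by (simp add: msum_def)

lemma e_mat_carrier [simp]: "e_mat N j k \<in> carrier_mat N N"
  by (simp add: e_mat_def)

lemma x_mat_carrier [simp]: "x_mat N j \<in> carrier_mat N N"
  by (simp add: x_mat_def)

lemma y_mat_carrier [simp]: "y_mat N j \<in> carrier_mat N N"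
  by (simp add: y_mat_def minus_carrier_mat)

lemma s_mat_carrier [simp]: "s_mat N j k \<in> carrier_mat N N"
  by (simp add: s_mat_def)

lemma x_mat_entry:
  "s < N \<Longrightarrow> t < N \<Longrightarrow> x_mat N (Suc j) $$ (s, t) = matrix_unit j (Suc j) s t + matrix_unit (Suc j) j s t"
  by (auto simp: x_mat_def e_mat_def matrix_unit_def)

lemma y_mat_entry:
  "s < N \<Longrightarrow> t < N \<Longrightarrow> y_mat N (Suc j) $$ (s, t) = \<i> * (matrix_unit j (Suc j) s t - matrix_unit (Suc j) j s t)"
  by (auto simp: y_mat_def e_mat_def matrix_unit_def)

lemma msum_entry: "a < n \<Longrightarrow> b < n \<Longrightarrow> msum n f I $$ (a, b) = (\<Sum>i\<in>I. f i $$ (a, b))"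
  by (simp add: msum_def)

lemma H_carrier:
  "H_S N E \<in> carrier_mat N N" "H_ctrl_S N d \<in> carrier_mat N N" "H_A M w c \<in> carrier_mat (2^M) (2^M)"
  "H_SA N M g \<in> carrier_mat (N * 2^M) (N * 2^M)"
  by (simp_all add: H_S_def H_ctrl_S_def H_A_def H_SA_def)

lemma H_0_carrier: "H_0 N M E d w c g \<in> carrier_mat (N * 2^M) (N * 2^M)"
  unfolding H_0_def using H_carrier(4)[of N M g] by (intro add_carrier_mat)

lemma H_A_entry:
  assumes "a < 2^M" "b < 2^M"
  shows "H_A M w c $$ (a, b)
    = (\<Sum>j\<in>{1..M}. w j * qubits M (\<lambda>i. pauli_op (ham_labels M (Zeeman j) i)) a b)
    + (\<Sum>j\<in>{1..M-1}. c j * qubits M (\<lambda>i. pauli_op (ham_labels M (Coupling j) i)) a b)"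
proof -
  note car = sigma_on_carrier[THEN carrier_matD(1)] sigma_on_carrier[THEN carrier_matD(2)]
  have "H_A M w c $$ (a, b) = (\<Sum>j\<in>{1..M}. (complex_of_real (w j) \<cdot>\<^sub>m sigma_on M j PZ) $$ (a, b))
    + (\<Sum>j\<in>{1..M-1}. (complex_of_real (c j) \<cdot>\<^sub>m (sigma_on M j PX * sigma_on M (j+1) PX)) $$ (a, b))"
    unfolding H_A_def using assms msum_carrier[of "2^M"]
    by (simp add: msum_entry carrier_matD[OF msum_carrier])
  also have "(\<Sum>j\<in>{1..M}. (complex_of_real (w j) \<cdot>\<^sub>m sigma_on M j PZ) $$ (a, b))
    = (\<Sum>j\<in>{1..M}. w j * qubits M (\<lambda>i. pauli_op (ham_labels M (Zeeman j) i)) a b)"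
    using assms by (intro sum.cong refl) (simp add: car sigma_on_entry)
  also have "(\<Sum>j\<in>{1..M-1}. (complex_of_real (c j) \<cdot>\<^sub>m (sigma_on M j PX * sigma_on M (j+1) PX)) $$ (a, b))
    = (\<Sum>j\<in>{1..M-1}. c j * qubits M (\<lambda>i. pauli_op (ham_labels M (Coupling j) i)) a b)"
  proof (intro sum.cong refl)
    fix j assume j: "j \<in> {1..M-1}"
    have "(complex_of_real (c j) \<cdot>\<^sub>m (sigma_on M j PX * sigma_on M (j+1) PX)) $$ (a, b)
        = c j * (sigma_on M j PX * sigma_on M (j+1) PX) $$ (a, b)"
      using assms by (intro index_smult_mat) (simp_all add: car)
    then show "(complex_of_real (c j) \<cdot>\<^sub>m (sigma_on M j PX * sigma_on M (j+1) PX)) $$ (a, b)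
        = c j * qubits M (\<lambda>i. pauli_op (ham_labels M (Coupling j) i)) a b"
      unfolding sigma_on_pair_entry[OF j assms] by simp
  qed
  finally show ?thesis .
qed

lemma H_0_entry:
  fixes E d w c :: "nat \<Rightarrow> real" and g :: "nat \<Rightarrow> nat \<Rightarrow> pauli list \<Rightarrow> real"
  assumes ab: "a < N * 2^M" "b < N * 2^M"
  defines "K \<equiv> \<lambda>s t. H_S N E $$ (s, t) + H_ctrl_S N d $$ (s, t)"
  shows "H_0 N M E d w c g $$ (a, b)
    = (\<Sum>t\<in>local_terms M \<union> interaction_terms N M. complex_of_real (ham_coeff w c g t) * ham_tens N M K t a b)"
proof -
  have d: "a div 2^M < N" "b div 2^M < N" "a mod 2^M < 2^M" "b mod 2^M < 2^M"
    using ab by (simp_all add: less_mult_imp_div_less)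
  have car: "kron (H_S N E) (1\<^sub>m (2^M)) \<in> carrier_mat (N * 2^M) (N * 2^M)"
    "kron (H_ctrl_S N d) (1\<^sub>m (2^M)) \<in> carrier_mat (N * 2^M) (N * 2^M)"
    "kron (1\<^sub>m N) (H_A M w c) \<in> carrier_mat (N * 2^M) (N * 2^M)"
    "H_SA N M g \<in> carrier_mat (N * 2^M) (N * 2^M)"
    by (intro kron_carrier H_carrier one_carrier_mat)+
  have one: "(1\<^sub>m (2^M) :: complex mat) $$ (x, y) = qubits M (\<lambda>i. pauli_op P0) x y" if "x < 2^M" "y < 2^M" for x y
    using that by (simp add: qubits_one)
  have S: "kron (H_S N E) (1\<^sub>m (2^M)) $$ (a, b) + kron (H_ctrl_S N d) (1\<^sub>m (2^M)) $$ (a, b) = ham_tens N M K System a b"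
    by (simp add: kron_tens[OF H_carrier(1) one_carrier_mat one ab] kron_tens[OF H_carrier(2) one_carrier_mat one ab])
      (simp add: tens_def K_def algebra_simps)
  have A: "kron (1\<^sub>m N) (H_A M w c) $$ (a, b)
    = (\<Sum>j\<in>{1..M}. w j * ham_tens N M K (Zeeman j) a b) + (\<Sum>j\<in>{1..M-1}. c j * ham_tens N M K (Coupling j) a b)"
    unfolding kron_entry[OF one_carrier_mat H_carrier(3) ab] H_A_entry[OF d(3,4)] qubits_mod
    using d by (simp add: tens_def sys_one_def distrib_left sum_distrib_left mult_ac)
  have I: "H_SA N M g $$ (a, b) = (\<Sum>t\<in>interaction_terms N M. complex_of_real (ham_coeff w c g t) * ham_tens N M K t a b)"
    unfolding H_SA_def msum_entry[OF ab] sum_interaction_terms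
  proof (intro sum.cong refl)
    fix t assume "t \<in> {1..N-1} \<times> {1..2::nat} \<times> xy_strings M"
    then obtain j k as where t: "t = (j, k, as)" "length as = M"
      by (auto simp: xy_strings_def)
    have "kron (s_mat N j k) (pauli_string as) \<in> carrier_mat (N * 2^M) (N * 2^M)"
      using kron_carrier[OF s_mat_carrier conjunct1[OF pauli_string]] t by metis
    moreover have "kron (s_mat N j k) (pauli_string as) $$ (a, b) = ham_tens N M K (Interaction j k as) a b"
      unfolding ham_system.simps ham_labels.simps using pauli_string[of as] t
      by (intro kron_tens[OF s_mat_carrier _ _ ab]) auto
    ultimately show "(case t of (j, k, as) \<Rightarrow> complex_of_real (g j k as) \<cdot>\<^sub>m kron (s_mat N j k) (pauli_string as)) $$ (a, b)
      = (case t of (j, k, as) \<Rightarrow> complex_of_real (ham_coeff w c g (Interaction j k as)) * ham_tens N M K (Interaction j k as) a b)"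
      using ab t by simp
  qed
  have "H_0 N M E d w c g $$ (a, b) = kron (H_S N E) (1\<^sub>m (2^M)) $$ (a, b) + kron (H_ctrl_S N d) (1\<^sub>m (2^M)) $$ (a, b)
     + kron (1\<^sub>m N) (H_A M w c) $$ (a, b) + H_SA N M g $$ (a, b)"
    unfolding H_0_def using ab car[THEN carrier_matD(1)] car[THEN carrier_matD(2)] by simp
  then show ?thesis
    unfolding S A I sum.union_disjoint[OF finite_terms(2,1) terms_disjoint] sum_local_terms
    by simp
qed

lemma H_site_entry:
  assumes "j \<in> {1..M}" "a < N * 2^M" "b < N * 2^M"
  shows "kron (1\<^sub>m N) (sigma_on M j p) $$ (a, b)
    = tens M sys_one (\<lambda>i. pauli_op (if i = M - j then p else P0)) a b"
proof -
  have "a div 2^M < N" "b div 2^M < N"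
    using assms by (simp_all add: less_mult_imp_div_less)
  then show ?thesis
    using assms by (simp add: kron_tens[OF one_carrier_mat sigma_on_carrier sigma_on_entry])
      (simp add: tens_def sys_one_def)
qed

section \<open>Hermiticity and trace of Pauli tensors\<close>

lemma pauli_op_cnj: "cnj (pauli_op p x y) = pauli_op p y x"
  by (cases p) (auto simp: pauli_op.simps)

lemma tens_cnj:
  assumes "\<And>s t. s < N \<Longrightarrow> t < N \<Longrightarrow> cnj (A s t) = A t s" "a < N * 2^M" "b < N * 2^M"
  shows "cnj (tens M A (\<lambda>i. pauli_op (l i)) a b) = tens M A (\<lambda>i. pauli_op (l i)) b a"
  using assms by (simp add: tens_def qubits_def cnj_prod pauli_op_cnj less_mult_imp_div_less)

lemma tens_trace:
  "(\<Sum>a<N * 2^M. tens M A B a a) = (\<Sum>s<N. A s s) * (\<Prod>i<M. B i False False + B i True True)"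
proof -
  have "(\<Sum>a<N * 2^M. tens M A B a a) = (\<Sum>s<N. \<Sum>p<2^M. A s s * qubits M B p p)"
    unfolding sum_lessThan_mult
    by (intro sum.cong refl) (auto simp: tens_def qubits_def bit_add_mult_two_power)
  then show ?thesis
    unfolding qubits_def by (simp add: sum_prod_bits[where f = "\<lambda>i x. B i x x"]
        sum_distrib_left[symmetric] sum_distrib_right)
qed

text \<open>Real combinations of Hermitian tensors are Hermitian. The trace of a tensor is the
  product of the traces of its factors, so one traceless factor suffices.\<close>

lemma su_tens_sum:
  assumes X: "X \<in> carrier_mat (N * 2^M) (N * 2^M)"
    and eq: "\<And>a b. a < N * 2^M \<Longrightarrow> b < N * 2^M \<Longrightarrow>
      X $$ (a, b) = (\<Sum>t\<in>I. complex_of_real (q t) * tens M (A t) (\<lambda>i. pauli_op (l t i)) a b)"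
    and herm: "\<And>t i j. t \<in> I \<Longrightarrow> i < N \<Longrightarrow> j < N \<Longrightarrow> cnj (A t i j) = A t j i"
    and tr: "\<And>t. t \<in> I \<Longrightarrow> (\<Sum>s<N. A t s s) = 0 \<or> (\<exists>i<M. l t i \<noteq> P0)"
  shows "\<i> \<cdot>\<^sub>m X \<in> su (N * 2^M)"
proof (rule suI)
  show "\<i> \<cdot>\<^sub>m X \<in> carrier_mat (N * 2^M) (N * 2^M)" using X by simp
  fix a b assume ab: "a < N * 2^M" "b < N * 2^M"
  have "cnj (X $$ (b, a)) = X $$ (a, b)"
    unfolding eq[OF ab] eq[OF ab(2,1)] cnj_sum
    using tens_cnj[OF herm ab(2,1)] by (intro sum.cong refl) simp
  then show "(\<i> \<cdot>\<^sub>m X) $$ (a, b) = - cnj ((\<i> \<cdot>\<^sub>m X) $$ (b, a))"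
    using ab X by simp
next
  have zero: "(\<Sum>a<N * 2^M. tens M (A t) (\<lambda>i. pauli_op (l t i)) a a) = 0" if "t \<in> I" for t
    using tr[OF that] traceless2_pauli unfolding tens_trace by (auto simp: traceless2_def)
  have "mtrace (\<i> \<cdot>\<^sub>m X) = (\<Sum>a<N * 2^M. \<i> * X $$ (a, a))"
    using X by (simp add: mtrace_def)
  also have "\<dots> = \<i> * (\<Sum>a<N * 2^M. \<Sum>t\<in>I. complex_of_real (q t) * tens M (A t) (\<lambda>i. pauli_op (l t i)) a a)"
    by (simp add: eq sum_distrib_left[of \<i>])
  also have "\<dots> = \<i> * (\<Sum>t\<in>I. complex_of_real (q t) * (\<Sum>a<N * 2^M. tens M (A t) (\<lambda>i. pauli_op (l t i)) a a))"
    by (subst sum.swap) (simp add: sum_distrib_left)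
  finally show "mtrace (\<i> \<cdot>\<^sub>m X) = 0" by (simp add: zero)
qed

section \<open>Complete controllability\<close>

text \<open>Columns of \<open>G_mat\<close> are indexed by \<open>l < 2 (N - 1)\<close>, first all \<open>x\<^sub>j\<close>, then all \<open>y\<^sub>j\<close>.\<close>
definition col_mat :: "nat \<Rightarrow> nat \<Rightarrow> complex mat" where
  "col_mat N l = (if l < N - 1 then s_mat N (l + 1) 1 else s_mat N (l - (N - 1) + 1) 2)"

definition col_coeff :: "nat \<Rightarrow> (nat \<Rightarrow> nat \<Rightarrow> pauli list \<Rightarrow> real) \<Rightarrow> pauli list \<Rightarrow> nat \<Rightarrow> real" where
  "col_coeff N g as l = (if l < N - 1 then g (l + 1) 1 as else g (l - (N - 1) + 1) 2 as)"

lemma col_simps: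
  "l < N - 1 \<Longrightarrow> col_mat N l = s_mat N (Suc l) 1" "col_mat N (N - 1 + l) = s_mat N (Suc l) 2"
  "l < N - 1 \<Longrightarrow> col_coeff N g as l = g (Suc l) 1 as" "col_coeff N g as (N - 1 + l) = g (Suc l) 2 as"
  unfolding col_mat_def col_coeff_def by simp_all

lemma sum_cols:
  "(\<Sum>(j, k)\<in>{1..N-1} \<times> {1..2}. complex_of_real (g j k as) * s_mat N j k $$ (s, t))
    = (\<Sum>l<2 * (N - 1). complex_of_real (col_coeff N g as l) * col_mat N l $$ (s, t))"
proof -
  let ?h = "\<lambda>j k. complex_of_real (g j k as) * s_mat N j k $$ (s, t)"
  have "(\<Sum>(j, k)\<in>{1..N-1} \<times> {1..2}. ?h j k) = (\<Sum>j\<in>{1..N-1}. ?h j 1 + ?h j 2)"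
    by (simp add: sum.cartesian_product[symmetric] numeral_2_eq_2)
  also have "\<dots> = (\<Sum>p<N-1. ?h (Suc p) 1) + (\<Sum>p<N-1. ?h (Suc p) 2)"
    unfolding sum.distrib One_nat_def sum.atLeast1_atMost_eq ..
  also have "\<dots> = (\<Sum>p<N-1. complex_of_real (col_coeff N g as p) * col_mat N p $$ (s, t))
      + (\<Sum>p<N-1. complex_of_real (col_coeff N g as (N - 1 + p)) * col_mat N (N - 1 + p) $$ (s, t))"
    unfolding col_simps(2,4)
    by (intro arg_cong2[of _ _ _ _ "(+)"] sum.cong refl) (simp add: col_simps(1,3))
  also have "\<dots> = (\<Sum>l<2 * (N - 1). complex_of_real (col_coeff N g as l) * col_mat N l $$ (s, t))"
    unfolding sum_lessThan_mult by (simp add: numeral_2_eq_2)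
  finally show ?thesis .
qed

text \<open>\<open>h\<close> is row \<open>k\<close> of the inverse of \<open>G\<close>, written as
  adjugate over determinant; it recovers \<open>f k\<close> from the vector
  \<open>G f\<close>.\<close>

lemma lin_indep_rows:
  fixes G :: "real mat"
  assumes G: "G \<in> carrier_mat n n" and "det G \<noteq> 0" and "k < n"
  obtains h where "\<And>f. (\<Sum>r<n. complex_of_real (h r) * (\<Sum>l<n. complex_of_real (G $$ (r, l)) * f l)) = f k"
proof
  fix f :: "nat \<Rightarrow> complex"
  let ?h = "\<lambda>r. adj_mat G $$ (k, r) / det G"
  have adj: "(\<Sum>r<n. adj_mat G $$ (k, r) * G $$ (r, l)) = (if k = l then det G else 0)" if "l < n" for l
  proof -
    have "(\<Sum>r<n. adj_mat G $$ (k, r) * G $$ (r, l)) = (adj_mat G * G) $$ (k, l)"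
      using adj_mat(1)[OF G] G assms(3) that by (simp add: scalar_prod_def lessThan_atLeast0)
    also have "\<dots> = (if k = l then det G else 0)"
      unfolding adj_mat(3)[OF G] using assms(3) that by simp
    finally show ?thesis .
  qed
  have inv: "(\<Sum>r<n. ?h r * G $$ (r, l)) = of_bool (k = l)" if "l < n" for l
  proof -
    have "(\<Sum>r<n. ?h r * G $$ (r, l)) = (\<Sum>r<n. adj_mat G $$ (k, r) * G $$ (r, l)) / det G"
      by (simp add: sum_divide_distrib)
    then show ?thesis using adj[OF that] assms(2) by simp
  qed
  have "(\<Sum>r<n. complex_of_real (?h r) * (\<Sum>l<n. complex_of_real (G $$ (r, l)) * f l))
      = (\<Sum>l<n. complex_of_real (\<Sum>r<n. ?h r * G $$ (r, l)) * f l)"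
    unfolding of_real_sum sum_distrib_left sum_distrib_right
    by (subst sum.swap) (simp add: mult.assoc)
  also have "\<dots> = (\<Sum>l<n. if l = k then f k else 0)"
  proof (intro sum.cong refl)
    fix l assume "l \<in> {..<n}"
    then have "(\<Sum>r<n. ?h r * G $$ (r, l)) = of_bool (k = l)" by (intro inv) simp
    then show "complex_of_real (\<Sum>r<n. ?h r * G $$ (r, l)) * f l = (if l = k then f k else 0)"
      by (simp only:) simp
  qed
  finally show "(\<Sum>r<n. complex_of_real (?h r) * (\<Sum>l<n. complex_of_real (G $$ (r, l)) * f l)) = f k"
    using assms(3) by simp
qed

section \<open>Isolating the terms of the Hamiltonian\<close>

context controlled_lie_algebra
begin

lemma full_mem_lin:
  assumes "\<And>r. r \<in> I \<Longrightarrow> full_mem (A r)"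
    and eq: "\<And>s t. s < N \<Longrightarrow> t < N \<Longrightarrow> B s t = (\<Sum>r\<in>I. x r * A r s t)"
  shows "full_mem B"
  unfolding full_mem_def
proof (intro allI impI)
  fix C assume C: "\<forall>i<M. traceless2 (C i)"
  have "(\<lambda>a b. \<Sum>r\<in>I. x r * tens M (A r) C a b) \<in> L"
    using assms(1) C by (intro sum_mem smult[of "tens M _ C"]) (auto simp: full_mem_def)
  then show "tens M B C \<in> L"
  proof (rule cong)
    fix a b assume "a < N * 2^M" "b < N * 2^M"
    then have "a div 2^M < N" "b div 2^M < N"
      by (simp_all add: less_mult_imp_div_less)
    then show "(\<Sum>r\<in>I. x r * tens M (A r) C a b) = tens M B C a b"
      by (simp add: tens_def eq sum_distrib_right mult.assoc)
  qed
qed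

lemma traceless_mem_of_hamiltonian:
  assumes N: "N \<ge> 2" and M: "M > 2"
    and ham: "(\<lambda>a b. \<Sum>t\<in>local_terms M \<union> interaction_terms N M.
      complex_of_real (ham_coeff w c g t) * ham_tens N M K t a b) \<in> L"
    and c: "\<forall>j\<in>{1..M-1}. c j \<noteq> 0"
    and \<beta>: "\<forall>r<2*(N-1). \<beta> r \<in> xy_strings M" and det: "det (G_mat N g \<beta>) \<noteq> 0"
    and tr: "(\<Sum>a<N * 2^M. f a a) = 0"
  shows "f \<in> L"
proof (rule traceless_mem_of_ladder)
  show "(\<Sum>a<N * 2^M. f a a) = 0" by (rule tr)
  let ?q = "\<lambda>t. complex_of_real (ham_coeff w c g t)"
  let ?n = "2 * (N - 1)"
  have row: "full_mem (\<lambda>s t. \<Sum>(j, k)\<in>{1..N-1} \<times> {1..2}. complex_of_real (g j k as) * s_mat N j k $$ (s, t))"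
    if as: "as \<in> xy_strings M" for as
  proof -
    \<comment> \<open>On each qubit the filter uses whichever of X and Y does not occur in
      \<open>as\<close>, so an interaction term survives all filters only if its string is
      \<open>as\<close>.\<close>
    define r where "r i = (if rev as ! i = PX then PY else PX)" for i
    have as_xy: "rev as ! i \<in> {PX, PY}" if "i < M" for i
      using as that nth_mem[of i "rev as"] by (auto simp: xy_strings_def simp del: nth_mem)
    define T where "T = (\<lambda>(j, k). Interaction j k as) ` ({1..N-1} \<times> {1..2})"
    have no_local: "\<exists>i<M. ham_labels M t i \<in> {P0, r i}" if t: "t \<in> local_terms M" for t
    proof -
      consider "t = System" | j where "t = Zeeman j" "j \<in> {1..M}" | j where "t = Coupling j" "j \<in> {1..M-1}"
        using t by (auto simp: local_terms_def)
      then show ?thesis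
      proof cases
        case 1
        then have "ham_labels M t 0 = P0" by simp
        then show ?thesis using M by (intro exI[of _ 0]) simp
      next
        case 2
        \<comment> \<open>The term sits on digit \<open>M - j\<close>; digit 0 is free unless
          \<open>j = M\<close>.\<close>
        then have "ham_labels M t (if j = M then 1 else 0) = P0" by simp
        then show ?thesis using M by (intro exI[of _ "if j = M then 1 else 0"]) simp
      next
        case 3
        \<comment> \<open>The coupling occupies digits \<open>M - j\<close> and
          \<open>M - (j+1)\<close>. For \<open>j = M - 1\<close> these are 1 and 0, and digit 2
          exists because \<open>M > 2\<close>.\<close>
        then have "ham_labels M t (if j = M - 1 then 2 else 0) = P0" using M by auto
        then show ?thesis using M by (intro exI[of _ "if j = M - 1 then 2 else 0"]) simp
      qed
    qed
    have inter: "(\<forall>i<M. rev bs ! i \<notin> {P0, r i}) \<longleftrightarrow> bs = as" if "bs \<in> xy_strings M" for bs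
    proof
      assume *: "\<forall>i<M. rev bs ! i \<notin> {P0, r i}"
      have "rev bs = rev as"
      proof (rule nth_equalityI)
        show "length (rev bs) = length (rev as)" using as that by (simp add: xy_strings_def)
        fix i assume "i < length (rev bs)"
        then have i: "i < M" using that by (simp add: xy_strings_def)
        have "rev bs ! i \<in> {PX, PY}"
          using that i nth_mem[of i "rev bs"] by (auto simp: xy_strings_def simp del: nth_mem)
        moreover have "rev bs ! i \<noteq> r i" using * i by blast
        ultimately show "rev bs ! i = rev as ! i"
          using as_xy[OF i] by (cases "rev as ! i = PX") (auto simp: r_def)
      qed
      then show "bs = as" by simp
    next
      assume bs: "bs = as"
      show "\<forall>i<M. rev bs ! i \<notin> {P0, r i}"
      proof (intro allI impI)
        fix i assume "i < M"
        then show "rev bs ! i \<notin> {P0, r i}"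
          using as_xy[of i] unfolding bs by (cases "rev as ! i = PX") (auto simp: r_def)
      qed
    qed
    have Interaction_mem: "Interaction j k as \<in> interaction_terms N M" if "j \<in> {1..N-1}" "k \<in> {1..2}" for j k
      unfolding interaction_terms_def using that as by (intro image_eqI[of _ _ "(j, k, as)"]) auto
    have T: "{t \<in> local_terms M \<union> interaction_terms N M. \<forall>i\<in>{..<M}. ham_labels M t i \<notin> {P0, r i}} = T"
      (is "?F = T")
    proof (intro equalityI subsetI)
      fix t assume t: "t \<in> ?F"
      then have "t \<in> interaction_terms N M" using no_local by blast
      then obtain j k bs where "t = Interaction j k bs" "j \<in> {1..N-1}" "k \<in> {1..2}" "bs \<in> xy_strings M"
        by (auto simp: interaction_terms_def)
      then show "t \<in> T" using t inter[of bs] by (auto simp: T_def)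
    next
      fix t assume "t \<in> T"
      then show "t \<in> ?F" using Interaction_mem inter[OF as] by (auto simp: T_def)
    qed
    have "(\<lambda>a b. \<Sum>t\<in>T. ?q t * ham_tens N M K t a b) \<in> L"
      unfolding T[symmetric]
      by (rule filter_sites[OF _ _ _ _ ham]) (auto simp: finite_terms r_def)
    then have "tens M (\<lambda>s t. \<Sum>(j, k)\<in>{1..N-1} \<times> {1..2}. complex_of_real (g j k as) * s_mat N j k $$ (s, t))
        (\<lambda>i. pauli_op (rev as ! i)) \<in> L"
    proof (rule cong)
      fix a b
      show "(\<Sum>t\<in>T. ?q t * ham_tens N M K t a b)
        = tens M (\<lambda>s t. \<Sum>(j, k)\<in>{1..N-1} \<times> {1..2}. complex_of_real (g j k as) * s_mat N j k $$ (s, t))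
          (\<lambda>i. pauli_op (rev as ! i)) a b"
        unfolding T_def
        by (subst sum.reindex) (auto simp: inj_on_def tens_def case_prod_unfold sum_distrib_right mult.assoc)
    qed
    note mem = this
    show ?thesis
      unfolding full_mem_def
    proof (intro allI impI)
      fix C assume "\<forall>i<M. traceless2 (C i)"
      then show "tens M (\<lambda>s t. \<Sum>(j, k)\<in>{1..N-1} \<times> {1..2}. complex_of_real (g j k as) * s_mat N j k $$ (s, t)) C \<in> L"
        by (intro rotate_all[OF _ mem]) (use as_xy in fastforce)+
    qed
  qed
  have G: "G_mat N g \<beta> \<in> carrier_mat ?n ?n" "\<And>r l. r < ?n \<Longrightarrow> l < ?n \<Longrightarrow> G_mat N g \<beta> $$ (r, l) = col_coeff N g (\<beta> r) l"
    by (auto simp: G_mat_def col_coeff_def)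
  have cols: "full_mem (\<lambda>s t. col_mat N l $$ (s, t))" if l: "l < ?n" for l
  proof -
    \<comment> \<open>The isolated sums for the strings \<open>\<beta> r\<close> are the rows of
      \<open>G\<close> applied to the matrices \<open>col_mat N l\<close>; inverting
      \<open>G\<close> separates these.\<close>
    obtain h where h: "\<And>f. (\<Sum>r<?n. complex_of_real (h r) * (\<Sum>l<?n. complex_of_real (G_mat N g \<beta> $$ (r, l)) * f l)) = f l"
      by (rule lin_indep_rows[OF G(1) det l]) (rule that)
    show ?thesis
    proof (rule full_mem_lin)
      show "full_mem (\<lambda>s t. \<Sum>(j, k)\<in>{1..N-1} \<times> {1..2}. complex_of_real (g j k (\<beta> r)) * s_mat N j k $$ (s, t))"
        if "r \<in> {..<?n}" for r
        by (rule row) (use \<beta> that in simp)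
      fix s t
      show "col_mat N l $$ (s, t) = (\<Sum>r<?n. complex_of_real (h r) *
          (\<Sum>(j, k)\<in>{1..N-1} \<times> {1..2}. complex_of_real (g j k (\<beta> r)) * s_mat N j k $$ (s, t)))"
        unfolding sum_cols h[of "\<lambda>l. col_mat N l $$ (s, t)", symmetric]
        by (intro sum.cong refl) (simp add: G(2))
    qed
  qed
  have xy: "full_mem (\<lambda>s t. x_mat N (Suc j) $$ (s, t))" "full_mem (\<lambda>s t. y_mat N (Suc j) $$ (s, t))"
    if "Suc j < N" for j
  proof -
    have j: "j < N - 1" "j < ?n" "N - 1 + j < ?n" using that by auto
    show "full_mem (\<lambda>s t. x_mat N (Suc j) $$ (s, t))"
      using cols[OF j(2)] unfolding col_simps(1)[OF j(1)] by (simp add: s_mat_def)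
    show "full_mem (\<lambda>s t. y_mat N (Suc j) $$ (s, t))"
      using cols[OF j(3)] unfolding col_simps(2) by (simp add: s_mat_def)
  qed
  have lin2: "full_mem B" if "full_mem A" "full_mem A'"
    "\<And>s t. s < N \<Longrightarrow> t < N \<Longrightarrow> B s t = x * A s t + y * A' s t" for A A' B x y
    by (rule full_mem_lin[of "{True, False}" "\<lambda>r. if r then A else A'" B "\<lambda>r. if r then x else y"])
      (use that in auto)
  \<comment> \<open>The upward unit is \<open>(x - i y) / 2\<close>; the downward one below is
    \<open>(x + i y) / 2\<close>.\<close>
  show "full_mem (matrix_unit j (Suc j))" if "Suc j < N" for j
    by (rule lin2[OF xy[OF that], of _ "1/2" "-\<i>/2"])
      (use that in \<open>simp add: x_mat_entry y_mat_entry field_simps\<close>)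
  show "full_mem (matrix_unit (Suc j) j)" if "Suc j < N" for j
    by (rule lin2[OF xy[OF that], of _ "1/2" "\<i>/2"])
      (use that in \<open>simp add: x_mat_entry y_mat_entry field_simps\<close>)
  have s_full: "full_mem (\<lambda>s t. s_mat N j k $$ (s, t))" if "j \<in> {1..N-1}" for j k
    using xy[of "j - 1"] that by (auto simp: s_mat_def)
  \<comment> \<open>Every single interaction term is now in \<open>L\<close>, so \<open>H_SA\<close>
    can be subtracted and the local terms remain.\<close>
  have inter: "(\<lambda>a b. \<Sum>t\<in>interaction_terms N M. ?q t * ham_tens N M K t a b) \<in> L"
  proof (rule sum_mem, rule smult)
    fix t assume "t \<in> interaction_terms N M"
    then obtain j k as where t: "t = Interaction j k as" "j \<in> {1..N-1}" "as \<in> xy_strings M"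
      by (auto simp: interaction_terms_def)
    have "rev as ! i \<noteq> P0" if "i < M" for i
      using t(3) that nth_mem[of i "rev as"] by (auto simp: xy_strings_def simp del: nth_mem)
    then show "ham_tens N M K t \<in> L"
      using s_full[OF t(2), of k] t(1) unfolding full_mem_def by (simp add: traceless2_pauli)
  qed
  have loc: "(\<lambda>a b. \<Sum>t\<in>local_terms M. ?q t * ham_tens N M K t a b) \<in> L"
    using lin[OF ham inter, of "-1"]
    by (simp add: sum.union_disjoint[OF finite_terms(2,1) terms_disjoint])
  show "pair_mem k (Suc k)" if k: "Suc k < M" for k
  proof -
    \<comment> \<open>In the left-to-right count, this is the coupling that occupies digits
      \<open>k\<close> and \<open>Suc k\<close>.\<close>
    define j where "j = M - Suc k"
    have j: "j \<in> {1..M-1}" "M - j = Suc k" "M - (j + 1) = k" using k by (auto simp: j_def)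
    \<comment> \<open>Filtering with Z on both digits removes \<open>System\<close>, all Zeeman
      terms, and every coupling that misses one of the two.\<close>
    have F: "{t \<in> local_terms M. \<forall>i\<in>{k, Suc k}. ham_labels M t i \<notin> {P0, PZ}} = {Coupling j}"
      using j by (auto simp: local_terms_def split: if_splits)
    have "(\<lambda>a b. \<Sum>t\<in>{Coupling j}. ?q t * ham_tens N M K t a b) \<in> L"
      unfolding F[symmetric] by (rule filter_sites[OF _ _ _ _ loc]) (use k finite_terms in auto)
    then have "ham_tens N M K (Coupling j) \<in> L"
      using smult_cancel[of "complex_of_real (c j)"] c j(1) by simp
    then have "tens M sys_one ((\<lambda>_. pauli_op P0)(k := pauli_op PX, Suc k := pauli_op PX)) \<in> L"
      by (rule tens_mem_cong) (use j in auto)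
    then show ?thesis
      using k by (intro pair_memI) auto
  qed
qed (use M N in simp_all)

end

section \<open>The generators lie in \<open>su\<close>\<close>

lemma H_S_entry:
  assumes "s < N" "t < N"
  shows "H_S N E $$ (s, t) = (if s = t then complex_of_real (E (Suc s)) else 0)"
proof -
  have "H_S N E $$ (s, t) = (\<Sum>j\<in>{1..N}. if j = Suc s then if s = t then complex_of_real (E (Suc s)) else 0 else 0)"
    unfolding H_S_def msum_entry[OF assms]
    by (intro sum.cong refl) (use assms in \<open>auto simp: e_mat_def\<close>)
  then show ?thesis using assms by simp
qed

lemma s_mat_cnj:
  assumes "s < N" "t < N" "1 \<le> j"
  shows "cnj (s_mat N j k $$ (s, t)) = s_mat N j k $$ (t, s)"
proof -
  obtain i where "j = Suc i" using assms(3) by (cases j) auto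
  then show ?thesis
    using assms(1,2) by (auto simp: s_mat_def x_mat_entry y_mat_entry matrix_unit_def)
qed

lemma H_ctrl_S_entry:
  assumes "s < N" "t < N"
  shows "H_ctrl_S N d $$ (s, t) = (\<Sum>j\<in>{1..N-1}. complex_of_real (d j) * s_mat N j 1 $$ (s, t))"
  unfolding H_ctrl_S_def msum_entry[OF assms]
  by (intro sum.cong refl) (use assms carrier_matD[OF x_mat_carrier] in \<open>simp add: s_mat_def\<close>)

lemma H_ctrl_S_cnj:
  assumes "s < N" "t < N"
  shows "cnj (H_ctrl_S N d $$ (s, t)) = H_ctrl_S N d $$ (t, s)"
  unfolding H_ctrl_S_entry[OF assms] H_ctrl_S_entry[OF assms(2,1)] cnj_sum
  by (intro sum.cong refl) (use assms in \<open>simp add: s_mat_cnj\<close>)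

lemma H_ctrl_S_diag:
  assumes "s < N"
  shows "H_ctrl_S N d $$ (s, s) = 0"
  unfolding H_ctrl_S_entry[OF assms assms]
proof (intro sum.neutral ballI)
  fix j assume "j \<in> {1..N-1}"
  then obtain i where "j = Suc i" by (cases j) auto
  then show "complex_of_real (d j) * s_mat N j 1 $$ (s, s) = 0"
    using assms by (simp add: s_mat_def x_mat_entry matrix_unit_def)
qed

text \<open>For \<open>System\<close> the trace is the sum of the energies, since
  \<open>H_ctrl_S\<close> has zero diagonal; every other term carries a nontrivial Pauli matrix on
  some qubit.\<close>

lemma su_H_0:
  assumes M: "M > 2" and E: "(\<Sum>j=1..N. E j) = 0"
  shows "\<i> \<cdot>\<^sub>m H_0 N M E d w c g \<in> su (N * 2^M)"
proof (rule su_tens_sum[OF H_0_carrier H_0_entry])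
  let ?K = "\<lambda>s t. H_S N E $$ (s, t) + H_ctrl_S N d $$ (s, t)"
  fix t assume t: "t \<in> local_terms M \<union> interaction_terms N M"
  consider "t = System" | j where "t = Zeeman j" "j \<in> {1..M}" | j where "t = Coupling j" "j \<in> {1..M-1}"
    | j k as where "t = Interaction j k as" "1 \<le> j" "as \<in> xy_strings M"
    using t by (auto simp: local_terms_def interaction_terms_def)
  note t_cases = this
  show "cnj (ham_system N ?K t i j) = ham_system N ?K t j i" if "i < N" "j < N" for i j
    using t_cases
  proof cases
    case 1
    then show ?thesis using that H_S_entry[OF that] H_S_entry[OF that(2,1)] H_ctrl_S_cnj[OF that] by auto
  next
    case (4 j' k as)
    then show ?thesis using that by (simp add: s_mat_cnj)
  qed (auto simp: sys_one_def)
  show "(\<Sum>s<N. ham_system N ?K t s s) = 0 \<or> (\<exists>i<M. ham_labels M t i \<noteq> P0)"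
    using t_cases
  proof cases
    case 1
    have "(\<Sum>s<N. ?K s s) = complex_of_real (\<Sum>s<N. E (Suc s))"
      by (simp add: H_S_entry H_ctrl_S_diag)
    also have "(\<Sum>s<N. E (Suc s)) = 0"
      using E by (simp add: sum.atLeast1_atMost_eq)
    finally show ?thesis using 1 by simp
  next
    case (2 j)
    then show ?thesis by (intro disjI2 exI[of _ "M - j"]) auto
  next
    case (3 j)
    then show ?thesis by (intro disjI2 exI[of _ "M - j"]) auto
  next
    case (4 j k as)
    then have "rev as ! 0 \<in> {PX, PY}"
      using M nth_mem[of 0 "rev as"] by (auto simp: xy_strings_def simp del: nth_mem)
    then show ?thesis using 4 M by (intro disjI2 exI[of _ 0]) auto
  qed
qed

lemma su_H_site:
  assumes "j \<in> {1..M}" "p \<noteq> P0"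
  shows "\<i> \<cdot>\<^sub>m kron (1\<^sub>m N) (sigma_on M j p) \<in> su (N * 2^M)"
proof (rule su_tens_sum[where I = "{()}" and q = "\<lambda>_. 1" and A = "\<lambda>_. sys_one"
    and l = "\<lambda>_ i. if i = M - j then p else P0"])
  show "kron (1\<^sub>m N) (sigma_on M j p) \<in> carrier_mat (N * 2^M) (N * 2^M)"
    by (intro kron_carrier one_carrier_mat sigma_on_carrier)
qed (use assms in \<open>auto simp: H_site_entry sys_one_def intro!: exI[of _ "M - j"]\<close>)

lemma lie_gen_complex_gen:
  assumes "A \<in> S"
  shows "(\<lambda>a b. A $$ (a, b)) \<in> lie_gen_complex n S"
  by (rule lie_gen_complexI[OF lie_gen.gen[OF assms] lie_gen.zero]) simp

theorem theorem1:
  fixes N M :: nat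
    and E d w c :: "nat \<Rightarrow> real"
    and g :: "nat \<Rightarrow> nat \<Rightarrow> pauli list \<Rightarrow> real"
  assumes "N \<ge> 2" and "M > 2"
    and "(\<Sum>j=1..N. E j) = 0"
    and cond1: "\<forall>j\<in>{1..M-1}. c j \<noteq> 0"
    and cond2: "\<exists>\<beta>. (\<forall>r<2*(N-1). \<beta> r \<in> xy_strings M) \<and> det (G_mat N g \<beta>) \<noteq> 0"
    and cond3: "lie_gen N {\<i> \<cdot>\<^sub>m H_S N E, \<i> \<cdot>\<^sub>m H_ctrl_S N d} = su N"
  shows "lie_gen (2^M * N)
           ({\<i> \<cdot>\<^sub>m H_0 N M E d w c g}
            \<union> {\<i> \<cdot>\<^sub>m H_x N M j | j. j \<in> {1..M}}
            \<union> {\<i> \<cdot>\<^sub>m H_y N M j | j. j \<in> {1..M}})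
         = su (2^M * N)"
proof -
  define S where "S = {\<i> \<cdot>\<^sub>m H_0 N M E d w c g}
    \<union> {\<i> \<cdot>\<^sub>m H_x N M j | j. j \<in> {1..M}} \<union> {\<i> \<cdot>\<^sub>m H_y N M j | j. j \<in> {1..M}}"
  \<comment> \<open>The order of the factors that \<open>kron\<close> produces; the other order is
    restored at the end.\<close>
  let ?n = "N * 2^M"
  have S: "S \<subseteq> su ?n"
    using su_H_0[OF assms(2,3)] su_H_site[of _ M PX N] su_H_site[of _ M PY N]
    by (auto simp: S_def H_x_def H_y_def)
  then have S_car: "S \<subseteq> carrier_mat ?n ?n"
    using suD(1) by blast
  interpret complex_lie_algebra ?n "lie_gen_complex ?n S"
    by (rule complex_lie_algebra_lie_gen_complex[OF S_car])
  \<comment> \<open>In the complexification the factor \<open>i\<close> of a generator can be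
    divided out.\<close>
  have gen: "(\<lambda>a b. X $$ (a, b)) \<in> lie_gen_complex ?n S"
    if "\<i> \<cdot>\<^sub>m X \<in> S" "X \<in> carrier_mat ?n ?n" for X
  proof (rule smult_cancel)
    show "(\<lambda>a b. \<i> * X $$ (a, b)) \<in> lie_gen_complex ?n S"
      by (rule cong[OF lie_gen_complex_gen[OF that(1)]]) (use that(2) in simp)
  qed simp
  have site: "tens M sys_one ((\<lambda>_. pauli_op P0)(k := pauli_op p)) \<in> lie_gen_complex ?n S"
    if "k < M" "p \<in> {PX, PY}" for k p
  proof (rule cong[OF gen])
    \<comment> \<open>Digit \<open>k\<close> belongs to the control on qubit
      \<open>M - k\<close>.\<close>
    have j: "M - k \<in> {1..M}" "M - (M - k) = k" using that(1) by auto
    show "\<i> \<cdot>\<^sub>m kron (1\<^sub>m N) (sigma_on M (M - k) p) \<in> S"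
      using that(2) j(1) unfolding S_def H_x_def H_y_def by blast
    show "kron (1\<^sub>m N) (sigma_on M (M - k) p) \<in> carrier_mat ?n ?n"
      by (intro kron_carrier one_carrier_mat sigma_on_carrier)
    fix a b assume "a < ?n" "b < ?n"
    then show "kron (1\<^sub>m N) (sigma_on M (M - k) p) $$ (a, b)
        = tens M sys_one ((\<lambda>_. pauli_op P0)(k := pauli_op p)) a b"
      unfolding H_site_entry[OF j(1) \<open>a < ?n\<close> \<open>b < ?n\<close>] j(2)
      by (intro tens_cong[of N]) auto
  qed
  interpret controlled_lie_algebra N M "lie_gen_complex ?n S"
    by unfold_locales (simp_all add: site)
  have ham: "(\<lambda>a b. \<Sum>t\<in>local_terms M \<union> interaction_terms N M. complex_of_real (ham_coeff w c g t) *
      ham_tens N M (\<lambda>s t. H_S N E $$ (s, t) + H_ctrl_S N d $$ (s, t)) t a b) \<in> lie_gen_complex ?n S"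
    by (rule cong[OF gen[OF _ H_0_carrier[of N M E d w c g]]]) (simp_all add: S_def H_0_entry)
  obtain \<beta> where \<beta>: "\<forall>r<2*(N-1). \<beta> r \<in> xy_strings M" "det (G_mat N g \<beta>) \<noteq> 0"
    using cond2 by blast
  \<comment> \<open>Membership is shown in the complexification, where vanishing trace is enough,
    and descends to the real algebra because \<open>A\<close> is in \<open>su\<close>.\<close>
  have "A \<in> lie_gen ?n S" if A: "A \<in> su ?n" for A
  proof (rule su_lie_gen_complex[OF S A])
    have "(\<Sum>a<?n. A $$ (a, a)) = 0"
      using suD(1,3)[OF A] by (simp add: mtrace_def)
    then show "(\<lambda>a b. A $$ (a, b)) \<in> lie_gen_complex ?n S"
      by (rule traceless_mem_of_hamiltonian[OF assms(1,2) ham cond1 \<beta>])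
  qed
  then have "lie_gen ?n S = su ?n"
    using lie_gen_subset_su[OF S] by blast
  then show ?thesis
    by (simp add: S_def mult.commute)
qed

end
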